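(* Suppose that there exist $a,b\in(0,1)$ such that: (1) $a<b$; (2) $f_1$ is strictly concave on $[0,a]$ and strictly convex on $[a,1]$, and $f_2$ is strictly convex on $[0,b]$ and strictly concave on $[b,1]$; (3) $f_i,g_i\in C^2[0,1]$ for $i=1,2$; (4) for all $(x,y)\in[0,a]\times[b,1]$ there exists $(\hat x,\hat y)\in(0,a]\times[b,1)$ with $f_1(\hat x)>g_1(y)\frac{\hat x}{y}$ and $f_2(\hat y)>g_2(x)\frac{1-\hat y}{1-x}$. Suppose the Dynkin problem (DP) is zero-sum, that is, $f_1=-g_2$ and $f_2=-g_1$. Then every threshold-type solution of the DP is locally stable.
   Context: Process. Let $W=(W_t)_{t\ge0}$ be a one-dimensional standard Brownian motion on a filtered probability space with universally completed filtration $\mathbb F=(\mathcal F_t)_{t\ge0}$. Let $E=(0,1)$, $\zeta=\inf\{t\ge0: W_t\notin E\}$, and let $X_t=W_t$ for $0\le t<\zeta$ and $X_t=\Delta$ for $t\ge\zeta$ (including $t=\infty$), where $\Delta$ is a cemetery state. $\mathbb P^x,\mathbb E^x$ denote probability and expectation when the process starts at $x$ (for $x\in\{0,1\}$, $\zeta=0$ and the process is at $\Delta$ from time $0$). Every function $\phi$ is extended by $\phi(\Delta)=0$. $\mathcal T$ is the set of $\mathbb F$-stopping times with values in $[0,\infty]$. For a measurable set $A$, $D_A=\inf\{t\ge0: X_t\in A\}$ with $\inf\emptyset=\zeta$. Rewards. For $i=1,2$, $f_i,g_i,h_i$ are bounded continuous real functions on $[0,1]$ with $f_i\le h_i\le g_i$,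 vanishing at $0$ and $1$ (and at $\Delta$). Game (DP). Writing $-i$ for the player other than $i$, for $\tau_1,\tau_2\in\mathcal T$, $$M_i^x(\tau_1,\tau_2)=\mathbb E^x\big[f_i(X_{\tau_i})1_{\{\tau_i<\tau_{-i}\}}+g_i(X_{\tau_{-i}})1_{\{\tau_{-i}<\tau_i\}}+h_i(X_{\tau_i})1_{\{\tau_i=\tau_{-i}\}}\big].$$ A pair $(\tau_1^*,\tau_2^* )\in\mathcal T\times\mathcal T$ is a solution to the DP if for every $x\in E$, $M_1^x(\tau_1^*,\tau_2^* )=\sup_{\tau_1\in\mathcal T}M_1^x(\tau_1,\tau_2^* )$ and $M_2^x(\tau_1^*,\tau_2^* )=\sup_{\tau_2\in\mathcal T}M_2^x(\tau_1^*,\tau_2)$. A solution is of threshold type if it has the form $(D_{[0,\ell']},D_{[r',1]})$ with $\ell',r'\in(0,1)$, $\ell'<r'$. Iteration in the DP. Given $\ell^{(1)}\in[0,a]$, put $A_1=[0,\ell^{(1)}]$ and for $n\ge1$ $$V_{2n}(x)=\sup_{\tau\in\mathcal T}\mathbb E^x\big[f_2(X_\tau)1_{\{\tau<D_{A_{2n-1}}\}}+g_2(X_{D_{A_{2n-1}}})1_{\{\tau\ge D_{A_{2n-1}}\}}\big],\quad A_{2n}=\{x\in[0,1]\setminus A_{2n-1}: V_{2n}(x)=f_2(x)\},$$ $$V_{2n+1}(x)=\sup_{\tau\in\mathcal T}\mathbb E^x\big[f_1(X_\tau)1_{\{\tau<D_{A_{2n}}\}}+g_1(X_{D_{A_{2n}}})1_{\{\tau\ge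 D_{A_{2n}}\}}\big],\quad A_{2n+1}=\{x\in[0,1]\setminus A_{2n}: V_{2n+1}(x)=f_1(x)\}.$$ Local stability. A solution $(D_{[0,\ell']},D_{[r',1]})$ of the DP is locally stable if there is a neighbourhood of $\ell'$ such that for every $\ell^{(1)}\in[0,a]$ in this neighbourhood the iteration satisfies $\liminf_n A_{2n-1}=\limsup_n A_{2n-1}=[0,\ell']$ and $\liminf_n A_{2n}=\limsup_n A_{2n}=[r',1]$, where limits of sequences of sets are in the Painlevé–Kuratowski sense. *)

theory Defs
  imports "HOL-Probability.Probability"
begin

section \<open>Brownian motion with an arbitrary starting point\<close>

text \<open>
  A filtered measurable space \<open>(M, G)\<close> carrying a continuous process \<open>W\<close> and a measurable family
  \<open>P x\<close> of probability measures under which \<open>W\<close> is a \<open>G\<close>-Brownian motion started at \<open>x\<close>. Time ranges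
  over \<open>[0,\<infinity>]\<close> in the filtration (so that the library's stopping times take values in \<open>[0,\<infinity>]\<close>),
  and over the reals \<open>t \<ge> 0\<close> in \<open>W\<close>. The filtration \<open>G\<close> is the raw one, before completion; it
  need not be the one generated by \<open>W\<close>.
\<close>

locale brownian_family = filtration "space M" G
  for M :: "'w measure" and G :: "ennreal \<Rightarrow> 'w measure" +
  fixes P :: "real \<Rightarrow> 'w measure" and W :: "real \<Rightarrow> 'w \<Rightarrow> real"
  assumes sets_G: "\<And>t. sets (G t) \<subseteq> sets M"
    and P_kernel: "P \<in> borel \<rightarrow>\<^sub>M prob_algebra M"
    and adapted: "\<And>t. 0 \<le> t \<Longrightarrow> W t \<in> borel_measurable (G (ennreal t))"
    and continuous_paths: "\<And>\<omega>. \<omega> \<in> space M \<Longrightarrow> continuous_on {0..} (\<lambda>t. W t \<omega>)"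
    and start: "\<And>x. AE \<omega> in P x. W 0 \<omega> = x"
    and increment_normal: "\<And>x s t. 0 \<le> s \<Longrightarrow> s < t \<Longrightarrow>
      distributed (P x) lborel (\<lambda>\<omega>. W t \<omega> - W s \<omega>) (normal_density 0 (sqrt (t - s)))"
    and increment_indep: "\<And>x s t. 0 \<le> s \<Longrightarrow> s < t \<Longrightarrow>
      prob_space.indep_set (P x) (sets (G (ennreal s)))
        (sets (vimage_algebra (space M) (\<lambda>\<omega>. W t \<omega> - W s \<omega>) borel))"

text \<open>
  Universal completion: the intersection, over all initial laws \<open>\<mu>\<close>, of the \<open>\<sigma>\<close>-algebras generated
  by \<open>G t\<close> and the null sets of the completion of \<open>P\<^sup>\<mu> = \<integral> P x \<mu>(dx)\<close>, written \<open>\<mu> \<bind> P\<close> in the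
  Giry monad.
\<close>

definition universal_completion ::
    "'w measure \<Rightarrow> (real \<Rightarrow> 'w measure) \<Rightarrow> (ennreal \<Rightarrow> 'w measure) \<Rightarrow> ennreal \<Rightarrow> 'w measure" where
  "universal_completion M P G t = sigma (space M)
     (\<Inter>\<mu>\<in>space (prob_algebra borel).
        sigma_sets (space M) (sets (G t) \<union> null_sets (completion (\<mu> \<bind> P))))"

lemma (in brownian_family) sets_universal_completion:
  "sets (universal_completion M P G t) =
     (\<Inter>\<mu>\<in>space (prob_algebra borel).
        sigma_sets (space M) (sets (G t) \<union> null_sets (completion (\<mu> \<bind> P))))"
proof -
  let ?S = "\<lambda>\<mu>. sigma_sets (space M) (sets (G t) \<union> null_sets (completion (\<mu> \<bind> P)))"
  have gen: "sets (G t) \<union> null_sets (completion (\<mu> \<bind> P)) \<subseteq> Pow (space M)"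
    if \<mu>: "\<mu> \<in> space (prob_algebra borel)" for \<mu>
  proof -
    have s: "sets \<mu> = sets borel" and p: "prob_space \<mu>"
      using \<mu> by (auto simp: space_prob_algebra)
    have ne: "space \<mu> \<noteq> {}" by (rule prob_space.not_empty[OF p])
    have K: "P \<in> borel \<rightarrow>\<^sub>M subprob_algebra M"
      by (rule measurable_prob_algebraD[OF P_kernel])
    have K\<mu>: "P \<in> \<mu> \<rightarrow>\<^sub>M subprob_algebra M"
      unfolding measurable_cong_sets[OF s refl] by (rule K)
    have "sets (P x) = sets M" if "x \<in> space \<mu>" for x
      using measurable_space[OF K\<mu> that] by (simp add: space_subprob_algebra)
    then have "space (\<mu> \<bind> P) = space M"
      by (intro space_bind ne)
    then have "null_sets (completion (\<mu> \<bind> P)) \<subseteq> Pow (space M)"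
      using sets.sets_into_space[of _ "completion (\<mu> \<bind> P)"] by (auto dest!: null_setsD2)
    moreover have "sets (G t) \<subseteq> Pow (space M)"
      using sets.space_closed[of "G t"] by (simp add: space_F)
    ultimately show ?thesis by blast
  qed
  have alg: "sigma_algebra (space M) (?S \<mu>)" if "\<mu> \<in> space (prob_algebra borel)" for \<mu>
    by (rule sigma_algebra_sigma_sets[OF gen[OF that]])
  have ne: "return borel 0 \<in> space (prob_algebra (borel :: real measure))"
    by (auto simp: space_prob_algebra intro!: prob_space_return)
  have sub: "(\<Inter>\<mu>\<in>space (prob_algebra borel). ?S \<mu>) \<subseteq> Pow (space M)"
    using ne sigma_sets_into_sp[OF gen[OF ne]] by blast
  have "sigma_sets (space M) (\<Inter>\<mu>\<in>space (prob_algebra borel). ?S \<mu>) \<subseteq> ?S \<nu>"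
    if "\<nu> \<in> space (prob_algebra borel)" for \<nu>
    by (rule sigma_algebra.sigma_sets_subset[OF alg[OF that]]) (use that in blast)
  then show ?thesis
    unfolding universal_completion_def sets_measure_of[OF sub] by blast
qed


section \<open>Brownian motion killed on exit from (0,1)\<close>

definition exit_time :: "(real \<Rightarrow> 'w \<Rightarrow> real) \<Rightarrow> 'w \<Rightarrow> ennreal" where
  "exit_time W \<omega> = Inf (ennreal ` {t. 0 \<le> t \<and> W t \<omega> \<notin> {0<..<1}})"

text \<open>The cemetery state is \<^term>\<open>None\<close>.\<close>

definition killed :: "(real \<Rightarrow> 'w \<Rightarrow> real) \<Rightarrow> ennreal \<Rightarrow> 'w \<Rightarrow> real option" where
  "killed W t \<omega> = (if t < exit_time W \<omega> then Some (W (enn2real t) \<omega>) else None)"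

definition ext0 :: "(real \<Rightarrow> real) \<Rightarrow> real option \<Rightarrow> real" where
  "ext0 \<phi> = case_option 0 \<phi>"

definition hitting_time :: "(real \<Rightarrow> 'w \<Rightarrow> real) \<Rightarrow> real set \<Rightarrow> 'w \<Rightarrow> ennreal" where
  "hitting_time W A \<omega> =
     (let S = {t. killed W t \<omega> \<in> Some ` A} in if S = {} then exit_time W \<omega> else Inf S)"

definition stopping_times :: "(ennreal \<Rightarrow> 'w measure) \<Rightarrow> ('w \<Rightarrow> ennreal) set" where
  "stopping_times F = {\<tau>. stopping_time F \<tau>}"

text \<open>
  Expectations are taken under the completed measures, since stopping times of the universally
  completed filtration need not be measurable with respect to \<open>M\<close>.
\<close>

abbreviation expect :: "(real \<Rightarrow> 'w measure) \<Rightarrow> real \<Rightarrow> ('w \<Rightarrow> real) \<Rightarrow> real" where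
  "expect P x Z \<equiv> integral\<^sup>L (completion (P x)) Z"


section \<open>The Dynkin game\<close>

text \<open>Expected reward of a player stopping at \<open>\<sigma>\<close> against an opponent stopping at \<open>\<tau>\<close>.\<close>

definition payoff :: "(real \<Rightarrow> 'w measure) \<Rightarrow> (real \<Rightarrow> 'w \<Rightarrow> real) \<Rightarrow>
    (real \<Rightarrow> real) \<Rightarrow> (real \<Rightarrow> real) \<Rightarrow> (real \<Rightarrow> real) \<Rightarrow>
    real \<Rightarrow> ('w \<Rightarrow> ennreal) \<Rightarrow> ('w \<Rightarrow> ennreal) \<Rightarrow> real" where
  "payoff P W f g h x \<sigma> \<tau> = expect P x (\<lambda>\<omega>.
       ext0 f (killed W (\<sigma> \<omega>) \<omega>) * of_bool (\<sigma> \<omega> < \<tau> \<omega>)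
     + ext0 g (killed W (\<tau> \<omega>) \<omega>) * of_bool (\<tau> \<omega> < \<sigma> \<omega>)
     + ext0 h (killed W (\<sigma> \<omega>) \<omega>) * of_bool (\<sigma> \<omega> = \<tau> \<omega>))"

definition dp_solution :: "(real \<Rightarrow> 'w measure) \<Rightarrow> (real \<Rightarrow> 'w \<Rightarrow> real) \<Rightarrow> (ennreal \<Rightarrow> 'w measure) \<Rightarrow>
    (real \<Rightarrow> real) \<Rightarrow> (real \<Rightarrow> real) \<Rightarrow> (real \<Rightarrow> real) \<Rightarrow>
    (real \<Rightarrow> real) \<Rightarrow> (real \<Rightarrow> real) \<Rightarrow> (real \<Rightarrow> real) \<Rightarrow>
    ('w \<Rightarrow> ennreal) \<Rightarrow> ('w \<Rightarrow> ennreal) \<Rightarrow> bool" where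
  "dp_solution P W F f1 g1 h1 f2 g2 h2 \<tau>1 \<tau>2 \<longleftrightarrow>
     \<tau>1 \<in> stopping_times F \<and> \<tau>2 \<in> stopping_times F \<and>
     (\<forall>x\<in>{0<..<1}.
        payoff P W f1 g1 h1 x \<tau>1 \<tau>2 = (SUP \<sigma>\<in>stopping_times F. payoff P W f1 g1 h1 x \<sigma> \<tau>2) \<and>
        payoff P W f2 g2 h2 x \<tau>2 \<tau>1 = (SUP \<sigma>\<in>stopping_times F. payoff P W f2 g2 h2 x \<sigma> \<tau>1))"

definition threshold_solution :: "(real \<Rightarrow> 'w measure) \<Rightarrow> (real \<Rightarrow> 'w \<Rightarrow> real) \<Rightarrow> (ennreal \<Rightarrow> 'w measure) \<Rightarrow>
    (real \<Rightarrow> real) \<Rightarrow> (real \<Rightarrow> real) \<Rightarrow> (real \<Rightarrow> real) \<Rightarrow>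
    (real \<Rightarrow> real) \<Rightarrow> (real \<Rightarrow> real) \<Rightarrow> (real \<Rightarrow> real) \<Rightarrow> real \<Rightarrow> real \<Rightarrow> bool" where
  "threshold_solution P W F f1 g1 h1 f2 g2 h2 l r \<longleftrightarrow>
     l \<in> {0<..<1} \<and> r \<in> {0<..<1} \<and> l < r \<and>
     dp_solution P W F f1 g1 h1 f2 g2 h2 (hitting_time W {0..l}) (hitting_time W {r..1})"


section \<open>Iterated best responses and local stability\<close>

definition response_value :: "(real \<Rightarrow> 'w measure) \<Rightarrow> (real \<Rightarrow> 'w \<Rightarrow> real) \<Rightarrow> (ennreal \<Rightarrow> 'w measure) \<Rightarrow>
    (real \<Rightarrow> real) \<Rightarrow> (real \<Rightarrow> real) \<Rightarrow> real set \<Rightarrow> real \<Rightarrow> real" where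
  "response_value P W F f g A x = (SUP \<tau>\<in>stopping_times F. expect P x (\<lambda>\<omega>.
       ext0 f (killed W (\<tau> \<omega>) \<omega>) * of_bool (\<tau> \<omega> < hitting_time W A \<omega>)
     + ext0 g (killed W (hitting_time W A \<omega>) \<omega>) * of_bool (\<tau> \<omega> \<ge> hitting_time W A \<omega>)))"

definition response_region :: "(real \<Rightarrow> 'w measure) \<Rightarrow> (real \<Rightarrow> 'w \<Rightarrow> real) \<Rightarrow> (ennreal \<Rightarrow> 'w measure) \<Rightarrow>
    (real \<Rightarrow> real) \<Rightarrow> (real \<Rightarrow> real) \<Rightarrow> real set \<Rightarrow> real set" where
  "response_region P W F f g A = {x \<in> {0..1} - A. response_value P W F f g A x = f x}"

text \<open>
  \<open>iterate \<dots> l n\<close> is \<open>A\<^sub>n\<close> for \<open>n \<ge> 1\<close>, started from \<open>A\<^sub>1 = [0,l]\<close>; the value at \<open>0\<close> is a dummy.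
\<close>

fun iterate :: "(real \<Rightarrow> 'w measure) \<Rightarrow> (real \<Rightarrow> 'w \<Rightarrow> real) \<Rightarrow> (ennreal \<Rightarrow> 'w measure) \<Rightarrow>
    (real \<Rightarrow> real) \<Rightarrow> (real \<Rightarrow> real) \<Rightarrow> (real \<Rightarrow> real) \<Rightarrow> (real \<Rightarrow> real) \<Rightarrow>
    real \<Rightarrow> nat \<Rightarrow> real set" where
  "iterate P W F f1 g1 f2 g2 l 0 = {}"
| "iterate P W F f1 g1 f2 g2 l (Suc 0) = {0..l}"
| "iterate P W F f1 g1 f2 g2 l (Suc (Suc n)) =
     (if even n
      then response_region P W F f2 g2 (iterate P W F f1 g1 f2 g2 l (Suc n))
      else response_region P W F f1 g1 (iterate P W F f1 g1 f2 g2 l (Suc n)))"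

text \<open>Lower and upper limits of a sequence of sets in the sense of Painlev\'e and Kuratowski.\<close>

definition pk_liminf :: "(nat \<Rightarrow> 'a::topological_space set) \<Rightarrow> 'a set" where
  "pk_liminf A = {x. \<forall>U. open U \<and> x \<in> U \<longrightarrow> (\<forall>\<^sub>F n in sequentially. U \<inter> A n \<noteq> {})}"

definition pk_limsup :: "(nat \<Rightarrow> 'a::topological_space set) \<Rightarrow> 'a set" where
  "pk_limsup A = {x. \<forall>U. open U \<and> x \<in> U \<longrightarrow> (\<exists>\<^sub>F n in sequentially. U \<inter> A n \<noteq> {})}"

definition locally_stable :: "(real \<Rightarrow> 'w measure) \<Rightarrow> (real \<Rightarrow> 'w \<Rightarrow> real) \<Rightarrow> (ennreal \<Rightarrow> 'w measure) \<Rightarrow>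
    (real \<Rightarrow> real) \<Rightarrow> (real \<Rightarrow> real) \<Rightarrow> (real \<Rightarrow> real) \<Rightarrow> (real \<Rightarrow> real) \<Rightarrow>
    real \<Rightarrow> real \<Rightarrow> real \<Rightarrow> bool" where
  "locally_stable P W F f1 g1 f2 g2 a l r \<longleftrightarrow>
     (\<exists>U. open U \<and> l \<in> U \<and> (\<forall>l1 \<in> U \<inter> {0..a}.
        let A = iterate P W F f1 g1 f2 g2 l1 in
          pk_liminf (\<lambda>n. A (2 * n + 1)) = {0..l} \<and> pk_limsup (\<lambda>n. A (2 * n + 1)) = {0..l} \<and>
          pk_liminf (\<lambda>n. A (2 * n + 2)) = {r..1} \<and> pk_limsup (\<lambda>n. A (2 * n + 2)) = {r..1}))"


section \<open>Assumptions on the rewards\<close>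

definition reward_functions :: "(real \<Rightarrow> real) \<Rightarrow> (real \<Rightarrow> real) \<Rightarrow> (real \<Rightarrow> real) \<Rightarrow> bool" where
  "reward_functions f g h \<longleftrightarrow>
     (\<forall>\<phi>\<in>{f, g, h}. continuous_on {0..1} \<phi> \<and> bounded (\<phi> ` {0..1}) \<and> \<phi> 0 = 0 \<and> \<phi> 1 = 0) \<and>
     (\<forall>x\<in>{0..1}. f x \<le> h x \<and> h x \<le> g x)"

definition strictly_convex_on :: "real set \<Rightarrow> (real \<Rightarrow> real) \<Rightarrow> bool" where
  "strictly_convex_on S f \<longleftrightarrow> convex S \<and>
     (\<forall>x\<in>S. \<forall>y\<in>S. \<forall>u>0. \<forall>v>0. x \<noteq> y \<and> u + v = 1 \<longrightarrow> f (u * x + v * y) < u * f x + v * f y)"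

definition strictly_concave_on :: "real set \<Rightarrow> (real \<Rightarrow> real) \<Rightarrow> bool" where
  "strictly_concave_on S f \<longleftrightarrow> strictly_convex_on S (\<lambda>x. - f x)"

text \<open>Derivatives within \<open>S\<close>: they are one-sided at the endpoints of an interval.\<close>

definition C2_on :: "real set \<Rightarrow> (real \<Rightarrow> real) \<Rightarrow> bool" where
  "C2_on S f \<longleftrightarrow> (\<exists>f' f''.
     (\<forall>x\<in>S. (f has_real_derivative f' x) (at x within S)) \<and>
     (\<forall>x\<in>S. (f' has_real_derivative f'' x) (at x within S)) \<and>
     continuous_on S f'')"

end

theory Submission
  imports Defs "HOL-Real_Asymp.Real_Asymp"
begin

text \<open>
  Against a threshold strategy the opponent plays an optimal stopping problem for Brownian motion on an
  interval, whose stopping region is read off from affine majorants: the response to \<open>[0,x]\<close> is \<open>[y,1]\<close>,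
  where the line through \<open>(x, g2 x)\<close> and \<open>(y, f2 y)\<close> is tangent to \<open>f2\<close> at \<open>y\<close>. Optional stopping is needed only
  for Brownian motion itself, since concave majorants are infima of affine ones. In the zero-sum game
  both players respond by minimising the slope \<open>S x y = (g1 y - f1 x) / (y - x)\<close> in their own variable, so
  the iteration is alternating minimisation of \<open>S\<close>. A coordinatewise minimum of \<open>S\<close> is a common tangent
  of the graphs of \<open>f1\<close> and \<open>g1\<close>, hence unique; by compactness the iteration converges to it from every
  starting point, and every threshold solution is such a minimum.
\<close>

section \<open>Exit times of a continuous path\<close>

text \<open>Two obstacles shape the probabilistic half. Stopping times refer to the universally
  completed filtration, while increments are known to be independent of the raw \<open>G\<close>
  only; so under each fixed \<open>P x\<close> the events \<open>s < r\<close> are traded for almost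
  surely equal events of \<open>G\<close>. And \<open>response_region\<close> asks for exact
  equality of value and reward. The value function is nevertheless never computed: a point is shown
  to stop by one affine majorant through its reward, and to continue by one exit interval that earns
  strictly more. The analytic half uses the zero-sum relation twice. It turns player 2's problem, to
  maximise the slope \<open>(f2 y - g2 x) / (y - x)\<close> in \<open>y\<close>, into minimising the
  same \<open>S x y\<close> that player 1 minimises in \<open>x\<close>; and it makes
  \<open>g1 = - f2\<close> strictly convex on \<open>[b,1]\<close>. Each partial minimisation is
  then that of a strictly convex function divided by a positive affine one (positive because
  \<open>a < b\<close>), so best responses are maps, and strictness upgrades equal slopes to equal
  points. Condition (4) keeps the responses away from 0 and 1.\<close>

definition exit_from :: "(real \<Rightarrow> 'w \<Rightarrow> real) \<Rightarrow> real \<Rightarrow> real \<Rightarrow> 'w \<Rightarrow> ennreal" where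
  "exit_from W c d \<omega> = Inf (ennreal ` {t. 0 \<le> t \<and> W t \<omega> \<notin> {c<..<d}})"

lemma exit_time_eq_exit_from: "exit_time W = exit_from W 0 1"
  by (simp add: fun_eq_iff exit_time_def exit_from_def)

lemma exit_from_le: "0 \<le> t \<Longrightarrow> W t \<omega> \<notin> {c<..<d} \<Longrightarrow> exit_from W c d \<omega> \<le> ennreal t"
  unfolding exit_from_def by (rule Inf_lower) blast

lemma before_exit_from: "0 \<le> s \<Longrightarrow> ennreal s < exit_from W c d \<omega> \<Longrightarrow> W s \<omega> \<in> {c<..<d}"
  using exit_from_le[of s W \<omega> c d] by (auto simp: not_le[symmetric])

text \<open>By path continuity the times spent outside an open interval form a closed set, so a
  finite infimum is attained.\<close>

lemma exit_from_cases:
  assumes cont: "continuous_on {0..} (\<lambda>t. W t \<omega>)"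
  obtains (finite) t where "0 \<le> t" "exit_from W c d \<omega> = ennreal t" "W t \<omega> \<notin> {c<..<d}"
    | (infinite) "exit_from W c d \<omega> = \<infinity>"
proof -
  define S where "S = {t. 0 \<le> t \<and> W t \<omega> \<notin> {c<..<d}}"
  show thesis
  proof (cases "S = {}")
    case True
    then have "exit_from W c d \<omega> = \<infinity>"
      unfolding exit_from_def S_def[symmetric] by (simp add: top_ennreal_def[symmetric])
    then show thesis by (rule infinite)
  next
    case False
    have "S = {0..} \<inter> (\<lambda>t. W t \<omega>) -` (- {c<..<d})"
      by (auto simp: S_def)
    also have "closed \<dots>"
      using continuous_closed_preimage[OF cont closed_atLeast, of "- {c<..<d}"]
      by (simp add: closed_Compl)
    finally have "closed S" .
    moreover have bdd: "bdd_below S"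
      by (rule bdd_belowI[of _ 0]) (auto simp: S_def)
    ultimately have mem: "Inf S \<in> S"
      using False closed_contains_Inf by blast
    have "exit_from W c d \<omega> = ennreal (Inf S)"
      unfolding exit_from_def S_def[symmetric]
      using mem bdd by (intro antisym Inf_lower Inf_greatest) (auto intro!: ennreal_leI cInf_lower)
    then show thesis
      using mem by (intro finite[of "Inf S"]) (auto simp: S_def)
  qed
qed

lemma exit_from_notin:
  assumes "continuous_on {0..} (\<lambda>t. W t \<omega>)" "exit_from W c d \<omega> < \<infinity>"
  shows "W (enn2real (exit_from W c d \<omega>)) \<omega> \<notin> {c<..<d}"
  by (rule exit_from_cases[of W \<omega> c d, OF assms(1)]) (use assms in auto)

lemma exit_from_start:
  assumes "W 0 \<omega> \<notin> {c<..<d}" shows "exit_from W c d \<omega> = 0"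
  using exit_from_le[of 0 W \<omega> c d] assms by simp

lemma exit_from_mono:
  assumes "{c'<..<d'} \<subseteq> {c<..<d}" shows "exit_from W c' d' \<omega> \<le> exit_from W c d \<omega>"
  unfolding exit_from_def by (intro Inf_superset_mono image_mono) (use assms in blast)

text \<open>Before the exit the path lies in the open interval; at the exit itself its value is a
  left limit of such values, hence in the closure. Time 0 has no left limit, which is why the
  starting point is assumed to lie in the closed interval.\<close>

lemma until_exit_from:
  assumes cont: "continuous_on {0..} (\<lambda>t. W t \<omega>)" and W0: "W 0 \<omega> \<in> {c..d}"
    and s: "0 \<le> s" "ennreal s \<le> exit_from W c d \<omega>"
  shows "W s \<omega> \<in> {c..d}"
proof (cases "s = 0")
  case False
  then have s0: "0 < s" using s by simp
  have "\<forall>\<^sub>F u in at_left s. W u \<omega> \<in> {c..d}"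
    unfolding eventually_at_left_field
  proof (intro exI[of _ 0] conjI allI impI s0)
    fix u assume u: "0 < u" "u < s"
    then have "ennreal u < ennreal s" by (simp add: ennreal_lessI)
    then have "ennreal u < exit_from W c d \<omega>" using s(2) by (rule less_le_trans)
    then show "W u \<omega> \<in> {c..d}" using before_exit_from[of u W c d \<omega>] u by auto
  qed
  moreover have "((\<lambda>u. W u \<omega>) \<longlongrightarrow> W s \<omega>) (at_left s)"
  proof -
    have "continuous_on {0<..} (\<lambda>t. W t \<omega>)"
      by (rule continuous_on_subset[OF cont]) auto
    then have "isCont (\<lambda>t. W t \<omega>) s"
      using s0 by (simp add: continuous_on_eq_continuous_at)
    then show ?thesis
      unfolding isCont_def by (rule tendsto_mono[rotated]) (simp add: at_le)
  qed
  ultimately show ?thesis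
    using Lim_in_closed_set[OF closed_atLeastAtMost, of "\<lambda>u. W u \<omega>" c d "at_left s" "W s \<omega>"] by simp
qed (use W0 in simp)

lemma at_exit_from:
  assumes "continuous_on {0..} (\<lambda>t. W t \<omega>)" "W 0 \<omega> \<in> {c..d}" "exit_from W c d \<omega> < \<infinity>"
  shows "W (enn2real (exit_from W c d \<omega>)) \<omega> \<in> {c, d}"
  using exit_from_notin[of W \<omega> c d, OF assms(1,3)] until_exit_from[of W \<omega> c d, OF assms(1,2), of "enn2real (exit_from W c d \<omega>)"]
    assms(3) by (auto simp: less_top[symmetric])

text \<open>While alive, the killed process stays in (0,1), so only the part of \<open>A\<close>
  inside (0,1) can be hit. Leaving \<open>(c,d)\<close> through 0 or 1 is death, and the convention
  that an empty infimum is the lifetime assigns it exactly the exit time. This reduces both players'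
  threshold strategies to one family of times.\<close>

lemma hitting_time_eq_exit_from:
  assumes cont: "continuous_on {0..} (\<lambda>t. W t \<omega>)"
    and sub: "{c<..<d} \<subseteq> {0<..<1}" and A: "A \<inter> {0<..<1} = {0<..<1} - {c<..<d}"
  shows "hitting_time W A \<omega> = exit_from W c d \<omega>"
proof -
  define S where "S = {t. killed W t \<omega> \<in> Some ` A}"
  let ?Z = "exit_from W 0 1 \<omega>" and ?T = "exit_from W c d \<omega>"
  have S_iff: "t \<in> S \<longleftrightarrow> t < ?Z \<and> W (enn2real t) \<omega> \<notin> {c<..<d}" for t
  proof (cases "t < ?Z")
    case True
    then have "t < \<top>" by (rule order_less_le_trans) simp
    then have "ennreal (enn2real t) < ?Z" using True by simp
    then have "W (enn2real t) \<omega> \<in> {0<..<1}" by (intro before_exit_from) auto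
    then show ?thesis using True A by (auto simp: S_def killed_def exit_time_eq_exit_from)
  qed (auto simp: S_def killed_def exit_time_eq_exit_from)
  have lower: "?T \<le> t" if "t \<in> S" for t
  proof -
    from that have t: "t < ?Z" "W (enn2real t) \<omega> \<notin> {c<..<d}" by (auto simp: S_iff)
    from t(1) have "t < \<top>" by (rule order_less_le_trans) simp
    moreover have "?T \<le> ennreal (enn2real t)" using t by (intro exit_from_le) auto
    ultimately show ?thesis by simp
  qed
  have mem: "?T \<in> S" if "?T < ?Z"
  proof -
    have "?T < \<infinity>" using that by (rule order_less_le_trans) simp
    then show ?thesis using exit_from_notin[of W \<omega> c d, OF cont] that by (simp add: S_iff)
  qed
  have le: "?T \<le> ?Z" by (rule exit_from_mono[OF sub])
  show ?thesis
  proof (cases "S = {}")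
    case True
    then have "\<not> ?T < ?Z" using mem by auto
    then show ?thesis
      using True le by (simp add: hitting_time_def S_def[symmetric] exit_time_eq_exit_from)
  next
    case False
    then obtain t where "t \<in> S" by auto
    then have "?T < ?Z" using lower[of t] by (auto simp: S_iff)
    then have "Inf S = ?T" using mem lower by (intro antisym Inf_lower Inf_greatest) auto
    then show ?thesis using False by (simp add: hitting_time_def S_def[symmetric])
  qed
qed

text \<open>The minimum in the formula is nonpositive exactly outside the interval. On the compact
  set \<open>[0,t]\<close> it attains its infimum, which by continuity can be read off from the
  grids \<open>t * k / (n + 1)\<close>. Only countably many times, none beyond \<open>t\<close>, are
  inspected, so the event belongs to the raw \<open>G t\<close> and no right-continuity is called
  for.\<close>

lemma exit_from_le_iff:
  assumes cont: "continuous_on {0..} (\<lambda>t. W t \<omega>)" and t: "0 \<le> t"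
  shows "exit_from W c d \<omega> \<le> ennreal t \<longleftrightarrow>
    (\<forall>m::nat. \<exists>n::nat. \<exists>k\<in>{..Suc n}.
       min (W (t * real k / real (Suc n)) \<omega> - c) (d - W (t * real k / real (Suc n)) \<omega>) < 1 / real (Suc m))"
    (is "_ \<longleftrightarrow> ?rhs")
proof -
  define \<phi> where "\<phi> s = min (W s \<omega> - c) (d - W s \<omega>)" for s
  have cont\<phi>: "continuous_on {0..} \<phi>"
    unfolding \<phi>_def by (intro continuous_intros cont)
  have \<phi>_iff: "\<phi> s \<le> 0 \<longleftrightarrow> W s \<omega> \<notin> {c<..<d}" for s
    by (auto simp: \<phi>_def min_le_iff_disj)
  show ?thesis
    unfolding \<phi>_def[symmetric]
  proof
    assume le: "exit_from W c d \<omega> \<le> ennreal t"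
    obtain s where s: "0 \<le> s" "s \<le> t" "\<phi> s \<le> 0"
      by (rule exit_from_cases[of W \<omega> c d, OF cont]) (use le t in \<open>auto simp: \<phi>_iff top_unique\<close>)
    \<comment> \<open>For \<open>t = 0\<close> the quotient is 0 by convention, and
      \<open>t * r = s\<close> survives because then \<open>s = 0\<close>.\<close>
    define r where "r = s / t"
    have r: "0 \<le> r" "r \<le> 1" "t * r = s"
      using s t by (auto simp: r_def divide_le_eq_1)
    define k where "k n = nat \<lfloor>r * real (Suc n)\<rfloor>" for n
    have k1: "real (k n) \<le> r * real (Suc n)" "r * real (Suc n) < real (k n) + 1" for n
    proof -
      have "0 \<le> r * real (Suc n)" using r by simp
      then have "real (k n) = of_int \<lfloor>r * real (Suc n)\<rfloor>" by (simp add: k_def)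
      then show "real (k n) \<le> r * real (Suc n)" "r * real (Suc n) < real (k n) + 1"
        by linarith+
    qed
    have k2: "k n \<le> Suc n" for n
    proof -
      have "r * real (Suc n) \<le> real (Suc n)" using r by (simp add: mult_left_le_one_le)
      then show ?thesis using k1(1)[of n] by linarith
    qed
    have lim: "(\<lambda>n. real (k n) / real (Suc n)) \<longlonglongrightarrow> r"
    proof (rule tendsto_sandwich)
      show "\<forall>\<^sub>F n in sequentially. r - 1 / real (Suc n) \<le> real (k n) / real (Suc n)"
      proof (intro always_eventually allI)
        fix n
        have "r * real (Suc n) - 1 \<le> real (k n)" using k1(2)[of n] by simp
        then have "(r * real (Suc n) - 1) / real (Suc n) \<le> real (k n) / real (Suc n)"
          by (rule divide_right_mono) simp
        then show "r - 1 / real (Suc n) \<le> real (k n) / real (Suc n)"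
          by (simp add: diff_divide_distrib)
      qed
      show "\<forall>\<^sub>F n in sequentially. real (k n) / real (Suc n) \<le> r"
        using k1(1) by (intro always_eventually allI) (simp add: field_simps)
      show "(\<lambda>n. r - 1 / real (Suc n)) \<longlonglongrightarrow> r"
        using tendsto_diff[OF tendsto_const[of r] LIMSEQ_Suc[OF lim_1_over_n]] by simp
    qed auto
    have "(\<lambda>n. t * real (k n) / real (Suc n)) \<longlonglongrightarrow> s"
      using tendsto_mult[OF tendsto_const[of t] lim] r(3) by simp
    then have lim\<phi>: "(\<lambda>n. \<phi> (t * real (k n) / real (Suc n))) \<longlonglongrightarrow> \<phi> s"
      using s t by (intro continuous_on_tendsto_compose[OF cont\<phi>]) auto
    show "\<forall>m. \<exists>n. \<exists>k\<in>{..Suc n}. \<phi> (t * real k / real (Suc n)) < 1 / real (Suc m)"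
    proof
      fix m :: nat
      have "\<phi> s < 1 / real (Suc m)" using s(3) by (rule order_le_less_trans) simp
      then have "\<forall>\<^sub>F n in sequentially. \<phi> (t * real (k n) / real (Suc n)) < 1 / real (Suc m)"
        using order_tendstoD(2)[OF lim\<phi>] by blast
      then obtain n where "\<phi> (t * real (k n) / real (Suc n)) < 1 / real (Suc m)"
        by (auto simp: eventually_sequentially)
      then show "\<exists>n. \<exists>k\<in>{..Suc n}. \<phi> (t * real k / real (Suc n)) < 1 / real (Suc m)"
        using k2 by blast
    qed
  next
    assume rhs: "\<forall>m. \<exists>n. \<exists>k\<in>{..Suc n}. \<phi> (t * real k / real (Suc n)) < 1 / real (Suc m)"
    have "continuous_on {0..t} \<phi>" by (rule continuous_on_subset[OF cont\<phi>]) auto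
    then obtain s where s: "s \<in> {0..t}" "\<And>u. u \<in> {0..t} \<Longrightarrow> \<phi> s \<le> \<phi> u"
      using continuous_attains_inf[of "{0..t}" \<phi>] t by auto
    have "\<phi> s \<le> 0"
    proof (rule ccontr)
      assume "\<not> \<phi> s \<le> 0"
      then obtain m where m: "1 / real (Suc m) < \<phi> s"
        using nat_approx_posE[of "\<phi> s"] by auto
      obtain n k where k: "k \<le> Suc n" "\<phi> (t * real k / real (Suc n)) < 1 / real (Suc m)"
        using rhs by blast
      have "t * real k \<le> t * real (Suc n)" using k(1) t by (intro mult_left_mono) auto
      then have "t * real k / real (Suc n) \<in> {0..t}"
        using t by (auto simp: divide_le_eq)
      from s(2)[OF this] k(2) m show False by simp
    qed
    then have "exit_from W c d \<omega> \<le> ennreal s"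
      using s by (intro exit_from_le) (auto simp: \<phi>_iff)
    also have "\<dots> \<le> ennreal t" using s by (intro ennreal_leI) auto
    finally show "exit_from W c d \<omega> \<le> ennreal t" .
  qed
qed

section \<open>Increments and the completed filtration\<close>

text \<open>The path at \<open>r\<close>, rounded up to the grid, is written as a discrete
  stochastic integral: the increment after \<open>k * \<delta>\<close> is weighted by the event
  \<open>k * \<delta> < r\<close>, which is already decided at time \<open>k * \<delta>\<close>.
  Rounding down would lose this.\<close>

lemma sum_telescope_of_bool:
  fixes w :: "real \<Rightarrow> real"
  assumes \<delta>: "0 < \<delta>" and r: "0 \<le> r" "r \<le> \<delta> * real m"
  shows "w (real (nat \<lceil>r / \<delta>\<rceil>) * \<delta>) - w 0 =
    (\<Sum>k<m. of_bool (real k * \<delta> < r) * (w (real (Suc k) * \<delta>) - w (real k * \<delta>)))"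
proof -
  define j where "j = nat \<lceil>r / \<delta>\<rceil>"
  have iff: "real k * \<delta> < r \<longleftrightarrow> k < j" for k
  proof -
    have "real k * \<delta> < r \<longleftrightarrow> real k < r / \<delta>" using \<delta> by (simp add: pos_less_divide_eq)
    also have "\<dots> \<longleftrightarrow> int k < \<lceil>r / \<delta>\<rceil>" by (simp add: less_ceiling_iff)
    finally show ?thesis by (auto simp: j_def zless_nat_eq_int_zless)
  qed
  have "j \<le> m"
  proof -
    have "r / \<delta> \<le> real m" using r \<delta> by (simp add: pos_divide_le_eq mult.commute)
    then show ?thesis by (simp add: j_def)
  qed
  then have "(\<Sum>k<m. of_bool (real k * \<delta> < r) * (w (real (Suc k) * \<delta>) - w (real k * \<delta>))) =
      (\<Sum>k<j. w (real (Suc k) * \<delta>) - w (real k * \<delta>))"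
    unfolding iff by (intro sum.mono_neutral_cong_right) auto
  also have "\<dots> = w (real j * \<delta>) - w 0"
    using sum_lessThan_telescope[of "\<lambda>k. w (real k * \<delta>)" j] by simp
  finally show ?thesis by (simp add: j_def)
qed

lemma tendsto_ceiling_multiple:
  fixes r T :: real
  assumes "0 \<le> r" "0 < T"
  shows "(\<lambda>n. real (nat \<lceil>r / (T / real (Suc n))\<rceil>) * (T / real (Suc n))) \<longlonglongrightarrow> r"
proof (rule tendsto_sandwich)
  have \<delta>: "0 < T / real (Suc n)" for n using assms by simp
  have lim0: "(\<lambda>n. T / real (Suc n)) \<longlonglongrightarrow> 0"
    using tendsto_mult[OF tendsto_const[of T] LIMSEQ_Suc[OF lim_1_over_n]] by simp
  have k: "r / (T / real (Suc n)) \<le> real (nat \<lceil>r / (T / real (Suc n))\<rceil>)"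
      "real (nat \<lceil>r / (T / real (Suc n))\<rceil>) \<le> r / (T / real (Suc n)) + 1" for n
  proof -
    have "0 \<le> r / (T / real (Suc n))" using assms \<delta>[of n] by (intro divide_nonneg_pos)
    then have "real (nat \<lceil>r / (T / real (Suc n))\<rceil>) = of_int \<lceil>r / (T / real (Suc n))\<rceil>"
      by (simp add: order_trans[OF _ le_of_int_ceiling])
    then show "r / (T / real (Suc n)) \<le> real (nat \<lceil>r / (T / real (Suc n))\<rceil>)"
      "real (nat \<lceil>r / (T / real (Suc n))\<rceil>) \<le> r / (T / real (Suc n)) + 1"
      by linarith+
  qed
  show "\<forall>\<^sub>F n in sequentially. r \<le> real (nat \<lceil>r / (T / real (Suc n))\<rceil>) * (T / real (Suc n))"
    using k(1) \<delta> by (intro always_eventually allI) (simp only: pos_divide_le_eq)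
  show "\<forall>\<^sub>F n in sequentially. real (nat \<lceil>r / (T / real (Suc n))\<rceil>) * (T / real (Suc n)) \<le> r + T / real (Suc n)"
  proof (intro always_eventually allI)
    fix n
    define \<delta> where "\<delta> = T / real (Suc n)"
    have "0 < \<delta>" using \<delta>[of n] by (simp only: \<delta>_def)
    have "real (nat \<lceil>r / \<delta>\<rceil>) * \<delta> \<le> (r / \<delta> + 1) * \<delta>"
      using k(2)[of n] \<open>0 < \<delta>\<close> unfolding \<delta>_def[symmetric] by (intro mult_right_mono) auto
    also have "\<dots> = r + \<delta>" using \<open>0 < \<delta>\<close> by (simp add: field_simps)
    finally show "real (nat \<lceil>r / (T / real (Suc n))\<rceil>) * (T / real (Suc n)) \<le> r + T / real (Suc n)"
      by (simp only: \<delta>_def)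
  qed
  show "(\<lambda>n. r) \<longlonglongrightarrow> r" by simp
  show "(\<lambda>n. r + T / real (Suc n)) \<longlonglongrightarrow> r"
    using tendsto_add[OF tendsto_const[of r] lim0] by simp
qed

context brownian_family
begin

abbreviation completed_filtration :: "ennreal \<Rightarrow> 'w measure" where
  "completed_filtration \<equiv> universal_completion M P G"

lemma P_in_space: "P x \<in> space (prob_algebra M)"
  using measurable_space[OF P_kernel, of x] by simp

lemma prob_space_P: "prob_space (P x)"
  and sets_P [measurable_cong]: "sets (P x) = sets M"
  and space_P: "space (P x) = space M"
  using P_in_space[of x] by (auto simp: space_prob_algebra dest: sets_eq_imp_space_eq)

lemma prob_space_completion_P: "prob_space (completion (P x))"
  by (rule prob_space.prob_space_completion[OF prob_space_P])

text \<open>Of all initial laws only the Dirac law at \<open>x\<close> is used; mixing the kernel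
  with it gives back \<open>P x\<close>.\<close>

lemma sigma_sets_completed_filtration:
  assumes "A \<in> sets (completed_filtration t)"
  shows "A \<in> sigma_sets (space M) (sets (G t) \<union> null_sets (completion (P x)))"
proof -
  have "return borel x \<in> space (prob_algebra borel)"
    by (auto simp: space_prob_algebra intro!: prob_space_return)
  moreover have "return borel x \<bind> P = P x"
    by (rule bind_return[OF measurable_prob_algebraD[OF P_kernel]]) simp
  ultimately show ?thesis
    using assms unfolding sets_universal_completion by (auto dest!: bspec[where x="return borel x"])
qed

text \<open>The bridge from the completed to the raw filtration: agreement up to a null set with
  some event of \<open>G t\<close> is inherited by complements and countable unions. The raw event
  depends on \<open>x\<close>, which is harmless since each expectation concerns a single starting
  point.\<close>

lemma completed_filtration_AE_eq:
  assumes "A \<in> sets (completed_filtration t)"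
  shows "\<exists>B\<in>sets (G t). AE \<omega> in completion (P x). \<omega> \<in> A \<longleftrightarrow> \<omega> \<in> B"
  using sigma_sets_completed_filtration[OF assms, of x]
proof (induction rule: sigma_sets.induct)
  case (Basic a)
  then show ?case
  proof
    assume "a \<in> null_sets (completion (P x))"
    then have "AE \<omega> in completion (P x). \<omega> \<in> a \<longleftrightarrow> \<omega> \<in> {}"
      by (auto dest: AE_not_in)
    then show ?thesis by blast
  qed auto
next
  case (Compl a)
  then obtain B where B: "B \<in> sets (G t)" "AE \<omega> in completion (P x). \<omega> \<in> a \<longleftrightarrow> \<omega> \<in> B" by blast
  have "AE \<omega> in completion (P x). \<omega> \<in> space M - a \<longleftrightarrow> \<omega> \<in> space (G t) - B"
    using B(2) AE_space by eventually_elim (simp add: space_F space_P)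
  then show ?case using B(1) by blast
next
  case (Union a)
  then obtain B where B: "\<And>i::nat. B i \<in> sets (G t)"
    "\<And>i. AE \<omega> in completion (P x). \<omega> \<in> a i \<longleftrightarrow> \<omega> \<in> B i" by metis
  have "AE \<omega> in completion (P x). \<forall>i. \<omega> \<in> a i \<longleftrightarrow> \<omega> \<in> B i"
    using B(2) by (simp add: AE_all_countable)
  then have "AE \<omega> in completion (P x). \<omega> \<in> (\<Union>i. a i) \<longleftrightarrow> \<omega> \<in> (\<Union>i. B i)"
    by eventually_elim auto
  then show ?case using B(1) by blast
qed auto

lemma space_completed_filtration: "space (completed_filtration t) = space M"
  unfolding universal_completion_def by (rule space_measure_of_conv)

lemma sets_completed_filtration_le: "sets (completed_filtration t) \<subseteq> sets (completion (P x))"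
proof
  fix A assume "A \<in> sets (completed_filtration t)"
  then have "A \<in> sigma_sets (space M) (sets (G t) \<union> null_sets (completion (P x)))"
    by (rule sigma_sets_completed_filtration)
  moreover have "sigma_sets (space (completion (P x))) (sets (G t) \<union> null_sets (completion (P x)))
      \<subseteq> sets (completion (P x))"
    using sets_G[of t] by (intro sets.sigma_sets_subset) (auto simp: sets_P)
  ultimately show "A \<in> sets (completion (P x))" by (auto simp: space_P)
qed

lemma sets_G_le_completed: "sets (G t) \<subseteq> sets (completed_filtration t)"
  unfolding sets_universal_completion by auto

lemma stopping_time_measurable:
  "stopping_time completed_filtration \<tau> \<Longrightarrow> \<tau> \<in> borel_measurable (completion (P x))"
  by (rule measurable_stopping_time[of completed_filtration])
    (use sets_completed_filtration_le in \<open>auto simp: space_completed_filtration space_P\<close>)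

lemma W_measurable_G: "0 \<le> s \<Longrightarrow> ennreal s \<le> t \<Longrightarrow> W s \<in> borel_measurable (G t)"
  using adapted[of s] measurable_mono[OF order_refl refl sets_F_mono[of "ennreal s" t]]
  by (auto simp: space_F)

lemma W_measurable_P: "0 \<le> s \<Longrightarrow> W s \<in> borel_measurable (P x)"
  using adapted[of s] measurable_mono[OF order_refl refl, of "G (ennreal s)" "P x"] sets_G
  by (auto simp: space_F space_P sets_P)

lemma W_measurable: "0 \<le> s \<Longrightarrow> W s \<in> borel_measurable (completion (P x))"
  by (intro measurable_completion W_measurable_P)

lemma stopping_time_exit_from: "stopping_time completed_filtration (exit_from W c d)"
proof (rule stopping_timeI)
  fix t :: ennreal
  have "Measurable.pred (G t) (\<lambda>\<omega>. exit_from W c d \<omega> \<le> t)"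
  proof (cases t rule: ennreal_cases)
    case (real u)
    have meas: "(\<lambda>\<omega>. W (u * real k / real (Suc n)) \<omega>) \<in> borel_measurable (G t)"
      if "k \<in> {..Suc n}" for k n
    proof -
      have "u * real k \<le> u * real (Suc n)" using that real by (intro mult_left_mono) auto
      then have "u * real k / real (Suc n) \<le> u" by (simp add: divide_le_eq)
      then show ?thesis
        using real that by (intro W_measurable_G) (auto intro: ennreal_leI)
    qed
    have "Measurable.pred (G t) (\<lambda>\<omega>. \<forall>m::nat. \<exists>n::nat. \<exists>k\<in>{..Suc n}.
       min (W (u * real k / real (Suc n)) \<omega> - c) (d - W (u * real k / real (Suc n)) \<omega>) < 1 / real (Suc m))"
      by (intro pred_intros_countable pred_intros_finite finite_atMost borel_measurable_pred_less
        borel_measurable_min borel_measurable_diff borel_measurable_const meas)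
    moreover have "exit_from W c d \<omega> \<le> t \<longleftrightarrow> (\<forall>m::nat. \<exists>n::nat. \<exists>k\<in>{..Suc n}.
       min (W (u * real k / real (Suc n)) \<omega> - c) (d - W (u * real k / real (Suc n)) \<omega>) < 1 / real (Suc m))"
      if "\<omega> \<in> space (G t)" for \<omega>
      using exit_from_le_iff[of W \<omega> u c d, OF continuous_paths] that real by (simp add: space_F)
    ultimately show ?thesis
      by (rule measurable_cong[THEN iffD2, rotated])
  qed simp
  then show "Measurable.pred (completed_filtration t) (\<lambda>\<omega>. exit_from W c d \<omega> \<le> t)"
    using sets_G_le_completed[of t]
    by (auto simp: Measurable.pred_def space_F space_completed_filtration)
qed

text \<open>Rounding \<open>r\<close> up to a grid leaves countably many values, for which
  measurability is immediate; path continuity then passes it to the limit.\<close>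

lemma stopped_W_measurable:
  assumes r: "r \<in> borel_measurable (completion (P x))" "\<And>\<omega>. \<omega> \<in> space M \<Longrightarrow> 0 \<le> r \<omega>"
  shows "(\<lambda>\<omega>. W (r \<omega>) \<omega>) \<in> borel_measurable (completion (P x))"
proof (rule borel_measurable_LIMSEQ_metric)
  let ?q = "\<lambda>n \<omega>. real (nat \<lceil>r \<omega> / (1 / real (Suc n))\<rceil>) * (1 / real (Suc n))"
  show "(\<lambda>\<omega>. W (?q n \<omega>) \<omega>) \<in> borel_measurable (completion (P x))" for n
    by (rule measurable_compose_countable[where f="\<lambda>k \<omega>. W (real k * (1 / real (Suc n))) \<omega>"])
      (use r(1) W_measurable in \<open>auto intro!: measurable_compose[OF _ measurable_count_space]\<close>)
  fix \<omega> assume \<omega>: "\<omega> \<in> space (completion (P x))"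
  then have \<omega>M: "\<omega> \<in> space M" by (simp add: space_P)
  have "(\<lambda>n. ?q n \<omega>) \<longlonglongrightarrow> r \<omega>"
    using r(2)[OF \<omega>M] by (intro tendsto_ceiling_multiple) auto
  moreover have "\<forall>\<^sub>F n in sequentially. ?q n \<omega> \<in> {0..}"
    unfolding atLeast_iff by (intro always_eventually allI mult_nonneg_nonneg of_nat_0_le_iff) simp
  ultimately show "(\<lambda>n. W (?q n \<omega>) \<omega>) \<longlonglongrightarrow> W (r \<omega>) \<omega>"
    using r(2)[OF \<omega>M] continuous_on_tendsto_compose[OF continuous_paths[OF \<omega>M]] by simp
qed

lemma increment_integrable:
  assumes st: "0 \<le> s" "s < t"
  shows "integrable (P x) (\<lambda>\<omega>. W t \<omega> - W s \<omega>)" "integrable (P x) (\<lambda>\<omega>. (W t \<omega> - W s \<omega>)\<^sup>2)"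
    "(\<integral>\<omega>. W t \<omega> - W s \<omega> \<partial>P x) = 0" "(\<integral>\<omega>. (W t \<omega> - W s \<omega>)\<^sup>2 \<partial>P x) = t - s"
proof -
  interpret prob_space "P x" by (rule prob_space_P)
  note D = increment_normal[OF st, of x]
  have \<sigma>: "0 < sqrt (t - s)" using st by simp
  show "integrable (P x) (\<lambda>\<omega>. W t \<omega> - W s \<omega>)"
    using distributed_integrable[OF D, of "\<lambda>x. x"] integrable_normal_moment_nz_1[OF \<sigma>, of 0] by simp
  show "integrable (P x) (\<lambda>\<omega>. (W t \<omega> - W s \<omega>)\<^sup>2)"
    using distributed_integrable[OF D, of "\<lambda>x. x\<^sup>2"] integrable_normal_moment[OF \<sigma>, of 0 2] by simp
  show E: "(\<integral>\<omega>. W t \<omega> - W s \<omega> \<partial>P x) = 0"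
    by (rule normal_distributed_expectation[OF \<sigma> D])
  show "(\<integral>\<omega>. (W t \<omega> - W s \<omega>)\<^sup>2 \<partial>P x) = t - s"
    using normal_distributed_variance[OF \<sigma> D] E st by simp
qed

lemma W_integrable:
  assumes "0 \<le> t"
  shows "integrable (P x) (W t)" "integrable (P x) (\<lambda>\<omega>. (W t \<omega>)\<^sup>2)"
proof -
  interpret prob_space "P x" by (rule prob_space_P)
  have [measurable]: "W t \<in> borel_measurable (P x)" "W 0 \<in> borel_measurable (P x)"
    using W_measurable_P assms by auto
  have D: "integrable (P x) (\<lambda>\<omega>. W t \<omega> - W 0 \<omega>)" "integrable (P x) (\<lambda>\<omega>. (W t \<omega> - W 0 \<omega>)\<^sup>2)"
    using increment_integrable[of 0 t x] assms by (cases "t = 0"; simp)+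
  have "integrable (P x) (\<lambda>\<omega>. x + (W t \<omega> - W 0 \<omega>))"
    using D by simp
  then show "integrable (P x) (W t)"
    by (rule integrable_cong_AE_imp) (use start[of x] in \<open>auto elim: eventually_mono\<close>)
  have "integrable (P x) (\<lambda>\<omega>. x\<^sup>2 + 2 * x * (W t \<omega> - W 0 \<omega>) + (W t \<omega> - W 0 \<omega>)\<^sup>2)"
    using D by simp
  then show "integrable (P x) (\<lambda>\<omega>. (W t \<omega>)\<^sup>2)"
    by (rule integrable_cong_AE_imp)
      (use start[of x] in \<open>auto elim!: eventually_mono simp: power2_eq_square algebra_simps\<close>)
qed

lemma expectation_W_0:
  "(\<integral>\<omega>. W 0 \<omega> \<partial>P x) = x" "(\<integral>\<omega>. (W 0 \<omega>)\<^sup>2 \<partial>P x) = x\<^sup>2"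
proof -
  interpret prob_space "P x" by (rule prob_space_P)
  have [measurable]: "W 0 \<in> borel_measurable (P x)" using W_measurable_P by auto
  have "(\<integral>\<omega>. W 0 \<omega> \<partial>P x) = (\<integral>\<omega>. x \<partial>P x)"
    by (rule integral_cong_AE) (use start[of x] in auto)
  then show "(\<integral>\<omega>. W 0 \<omega> \<partial>P x) = x" by (simp add: prob_space)
  have "(\<integral>\<omega>. (W 0 \<omega>)\<^sup>2 \<partial>P x) = (\<integral>\<omega>. x\<^sup>2 \<partial>P x)"
    by (rule integral_cong_AE) (use start[of x] in \<open>auto elim: eventually_mono\<close>)
  then show "(\<integral>\<omega>. (W 0 \<omega>)\<^sup>2 \<partial>P x) = x\<^sup>2" by (simp add: prob_space)
qed

lemma indep_var_increment:
  fixes X :: "'w \<Rightarrow> real" and \<phi> :: "real \<Rightarrow> real"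
  assumes st: "0 \<le> s" "s < t" and X: "X \<in> borel_measurable (G (ennreal s))"
    and \<phi>: "\<phi> \<in> borel_measurable borel"
  shows "prob_space.indep_var (P x) borel X borel (\<lambda>\<omega>. \<phi> (W t \<omega> - W s \<omega>))"
proof -
  interpret prob_space "P x" by (rule prob_space_P)
  let ?D = "\<lambda>\<omega>. W t \<omega> - W s \<omega>"
  have [measurable]: "W t \<in> borel_measurable (P x)" "W s \<in> borel_measurable (P x)"
    using W_measurable_P st by auto
  have XP: "X \<in> borel_measurable (P x)"
    using X measurable_mono[OF order_refl refl, of "G (ennreal s)" "P x"] sets_G
    by (auto simp: space_F space_P sets_P)
  have sub: "sigma_sets (space (P x)) {X -` A \<inter> space (P x) |A. A \<in> sets borel} \<subseteq> sets (G (ennreal s))"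
    using sets.sigma_sets_subset[of "{X -` A \<inter> space (P x) |A. A \<in> sets borel}" "G (ennreal s)"]
      measurable_sets[OF X] by (auto simp: space_F space_P)
  have sets_vim: "sets (vimage_algebra (space M) ?D borel) =
      sigma_sets (space (P x)) {?D -` A \<inter> space (P x) |A. A \<in> sets borel}"
    by (simp add: sets_vimage_algebra space_P)
  have "indep_set (sets (G (ennreal s))) (sets (vimage_algebra (space M) ?D borel))"
    by (rule increment_indep[OF st])
  then have "indep_set (sigma_sets (space (P x)) {X -` A \<inter> space (P x) |A. A \<in> sets borel})
     (sigma_sets (space (P x)) {?D -` A \<inter> space (P x) |A. A \<in> sets borel})"
    unfolding sets_vim using sub by (auto simp: indep_sets2_eq)
  then have "indep_var borel X borel ?D"
    unfolding indep_var_eq using XP by auto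
  then show ?thesis
    using indep_var_compose[of borel X borel ?D "\<lambda>x. x" borel \<phi> borel] \<phi> by (simp add: comp_def)
qed

text \<open>The two facts that drive optional stopping on a grid: an increment restricted to a past
  event has mean zero, and \<open>W t\<close> squared minus \<open>W s\<close> squared equals
  \<open>2 * W s\<close> times the increment plus its square, so restricted to \<open>B\<close> it
  has mean \<open>prob B * (t - s)\<close>.\<close>

lemma increment_orthogonal:
  assumes st: "0 \<le> s" "s < t" and B: "B \<in> sets (G (ennreal s))"
  shows "integrable (P x) (\<lambda>\<omega>. indicator B \<omega> * (W t \<omega> - W s \<omega>))"
    "(\<integral>\<omega>. indicator B \<omega> * (W t \<omega> - W s \<omega>) \<partial>P x) = 0"
    "integrable (P x) (\<lambda>\<omega>. indicator B \<omega> * ((W t \<omega>)\<^sup>2 - (W s \<omega>)\<^sup>2))"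
    "(\<integral>\<omega>. indicator B \<omega> * ((W t \<omega>)\<^sup>2 - (W s \<omega>)\<^sup>2) \<partial>P x) \<le> t - s"
proof -
  interpret prob_space "P x" by (rule prob_space_P)
  let ?D = "\<lambda>\<omega>. W t \<omega> - W s \<omega>"
  note D = increment_integrable[OF st, of x]
  have [measurable]: "B \<in> sets (G (ennreal s))" "W s \<in> borel_measurable (G (ennreal s))"
    using B adapted[OF st(1)] by auto
  have B'[measurable]: "B \<in> sets (P x)" using B sets_G[of "ennreal s"] by (auto simp: sets_P)
  have WP[measurable]: "W t \<in> borel_measurable (P x)" "W s \<in> borel_measurable (P x)"
    using W_measurable_P st by auto
  have i1: "indep_var borel (indicator B :: _ \<Rightarrow> real) borel ?D"
    by (rule indep_var_increment[OF st, of "indicator B" "\<lambda>x. x"]) measurable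
  have i2: "indep_var borel (\<lambda>\<omega>. indicator B \<omega> * W s \<omega>) borel ?D"
    by (rule indep_var_increment[OF st, of "\<lambda>\<omega>. indicator B \<omega> * W s \<omega>" "\<lambda>x. x"]) measurable
  have i3: "indep_var borel (indicator B :: _ \<Rightarrow> real) borel (\<lambda>\<omega>. (?D \<omega>)\<^sup>2)"
    by (rule indep_var_increment[OF st, of "indicator B" "\<lambda>x. x\<^sup>2"]) measurable
  have intB: "integrable (P x) (indicator B :: _ \<Rightarrow> real)"
    using B' by (simp add: emeasure_eq_measure)
  have intBW: "integrable (P x) (\<lambda>\<omega>. indicator B \<omega> * W s \<omega>)"
    using integrable_mult_indicator[OF B' W_integrable(1)[OF st(1)]] by simp
  show "integrable (P x) (\<lambda>\<omega>. indicator B \<omega> * ?D \<omega>)"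
    by (rule indep_var_integrable[OF i1 intB D(1)])
  show "(\<integral>\<omega>. indicator B \<omega> * ?D \<omega> \<partial>P x) = 0"
    using indep_var_lebesgue_integral[OF i1 intB D(1)] D(3) by simp
  have I2: "integrable (P x) (\<lambda>\<omega>. (indicator B \<omega> * W s \<omega>) * ?D \<omega>)"
    by (rule indep_var_integrable[OF i2 intBW D(1)])
  have E2: "(\<integral>\<omega>. (indicator B \<omega> * W s \<omega>) * ?D \<omega> \<partial>P x) = 0"
    using indep_var_lebesgue_integral[OF i2 intBW D(1)] D(3) by simp
  have I3: "integrable (P x) (\<lambda>\<omega>. indicator B \<omega> * (?D \<omega>)\<^sup>2)"
    by (rule indep_var_integrable[OF i3 intB D(2)])
  have E3: "(\<integral>\<omega>. indicator B \<omega> * (?D \<omega>)\<^sup>2 \<partial>P x) = prob B * (t - s)"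
    using indep_var_lebesgue_integral[OF i3 intB D(2)] D(4) B' by simp
  have eq: "indicator B \<omega> * ((W t \<omega>)\<^sup>2 - (W s \<omega>)\<^sup>2) =
      2 * ((indicator B \<omega> * W s \<omega>) * ?D \<omega>) + indicator B \<omega> * (?D \<omega>)\<^sup>2" for \<omega>
    by (simp add: power2_eq_square algebra_simps)
  show "integrable (P x) (\<lambda>\<omega>. indicator B \<omega> * ((W t \<omega>)\<^sup>2 - (W s \<omega>)\<^sup>2))"
    unfolding eq using I2 I3 by simp
  have "(\<integral>\<omega>. indicator B \<omega> * ((W t \<omega>)\<^sup>2 - (W s \<omega>)\<^sup>2) \<partial>P x) = prob B * (t - s)"
    unfolding eq using I2 I3 E2 E3 by simp
  also have "\<dots> \<le> t - s" using st by (intro mult_left_le_one_le) auto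
  finally show "(\<integral>\<omega>. indicator B \<omega> * ((W t \<omega>)\<^sup>2 - (W s \<omega>)\<^sup>2) \<partial>P x) \<le> t - s" .
qed

end

section \<open>Optional stopping\<close>

lemma exit_from_Int:
  "exit_from W (max c c') (min d d') \<omega> = min (exit_from W c d \<omega>) (exit_from W c' d' \<omega>)"
proof -
  have "{t. 0 \<le> t \<and> W t \<omega> \<notin> {max c c'<..<min d d'}} =
      {t. 0 \<le> t \<and> W t \<omega> \<notin> {c<..<d}} \<union> {t. 0 \<le> t \<and> W t \<omega> \<notin> {c'<..<d'}}"
    by auto
  then show ?thesis
    unfolding exit_from_def by (simp only: image_Un Inf_union_distrib inf_min)
qed

text \<open>A Chebyshev-type tail bound: a uniform second moment bound makes the truncation error of
  order \<open>1 / K\<close> uniformly.\<close>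

lemma abs_diff_truncation_le:
  fixes y K :: real
  assumes "0 < K"
  shows "\<bar>y - max (- K) (min K y)\<bar> \<le> y\<^sup>2 / K"
proof (cases "\<bar>y\<bar> \<le> K")
  case True
  then show ?thesis using assms by (auto simp: max_def min_def)
next
  case False
  then have "\<bar>y - max (- K) (min K y)\<bar> \<le> \<bar>y\<bar>" using assms by (auto simp: max_def min_def)
  also have "\<bar>y\<bar> \<le> y\<^sup>2 / K"
    using False assms mult_left_mono[of K "\<bar>y\<bar>" "\<bar>y\<bar>"] by (simp add: pos_le_divide_eq power2_eq_square)
  finally show ?thesis .
qed

context brownian_family
begin

lemma AE_start: "AE \<omega> in completion (P x). \<omega> \<in> space M \<and> W 0 \<omega> = x"
  using AE_completion[OF start[of x]] AE_space by eventually_elim (simp add: space_P)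

text \<open>
  Discretising \<open>r\<close> from above leaves the interval in which \<open>W\<close> is bounded; the uniform bound
  \<open>x\<^sup>2 + T\<close> on second moments provides the uniform integrability needed for the passage to the limit.
\<close>

lemma expectation_stopped_bounded_time:
  fixes r :: "'w \<Rightarrow> real"
  assumes T: "0 < T" and r: "\<And>\<omega>. \<omega> \<in> space M \<Longrightarrow> 0 \<le> r \<omega> \<and> r \<omega> \<le> T"
    and meas: "(\<lambda>\<omega>. W (r \<omega>) \<omega>) \<in> borel_measurable (completion (P x))"
    and adapt: "\<And>s. 0 \<le> s \<Longrightarrow> s < T \<Longrightarrow>
      \<exists>B\<in>sets (G (ennreal s)). AE \<omega> in completion (P x). s < r \<omega> \<longleftrightarrow> \<omega> \<in> B"
    and bounded: "AE \<omega> in completion (P x). \<bar>W (r \<omega>) \<omega>\<bar> \<le> K"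
  shows "expect P x (\<lambda>\<omega>. W (r \<omega>) \<omega>) = x"
proof -
  interpret C: prob_space "completion (P x)" by (rule prob_space_completion_P)
  obtain B where B: "\<And>s. 0 \<le> s \<Longrightarrow> s < T \<Longrightarrow> B s \<in> sets (G (ennreal s))"
    "\<And>s. 0 \<le> s \<Longrightarrow> s < T \<Longrightarrow> AE \<omega> in completion (P x). s < r \<omega> \<longleftrightarrow> \<omega> \<in> B s"
    using adapt by metis
  define \<delta> where "\<delta> n = T / real (Suc n)" for n
  define q where "q n \<omega> = real (nat \<lceil>r \<omega> / \<delta> n\<rceil>) * \<delta> n" for n \<omega>
  have \<delta>: "0 < \<delta> n" "\<delta> n * real (Suc n) = T" for n
    using T by (auto simp: \<delta>_def)
  have grid: "0 \<le> real k * \<delta> n" "real k * \<delta> n < T" "real k * \<delta> n < real (Suc k) * \<delta> n"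
    if "k < Suc n" for k n
  proof -
    show "0 \<le> real k * \<delta> n" using \<delta>(1)[of n] by simp
    show "real k * \<delta> n < T"
      using \<delta>[of n] that mult_strict_right_mono[of "real k" "real (Suc n)" "\<delta> n"] by (simp add: mult.commute)
    show "real k * \<delta> n < real (Suc k) * \<delta> n" using \<delta>(1)[of n] by (intro mult_strict_right_mono) auto
  qed
  \<comment> \<open>\<open>Y n\<close> is \<open>W\<close> at the rounded time \<open>q n\<close>,
    with the events \<open>k * \<delta> < r\<close> replaced by events of \<open>G\<close>;
    \<open>Q n\<close> is the same sum for squares. Almost surely \<open>Q n\<close> is the square
    of \<open>Y n\<close>, and its mean telescopes to at most \<open>x\<^sup>2 + T\<close>.\<close>
  define Y where "Y n \<omega> = W 0 \<omega> + (\<Sum>k<Suc n. indicator (B (real k * \<delta> n)) \<omega> *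
      (W (real (Suc k) * \<delta> n) \<omega> - W (real k * \<delta> n) \<omega>))" for n \<omega>
  define Q where "Q n \<omega> = (W 0 \<omega>)\<^sup>2 + (\<Sum>k<Suc n. indicator (B (real k * \<delta> n)) \<omega> *
      ((W (real (Suc k) * \<delta> n) \<omega>)\<^sup>2 - (W (real k * \<delta> n) \<omega>)\<^sup>2))" for n \<omega>
  have Y_eq: "AE \<omega> in completion (P x). Y n \<omega> = W (q n \<omega>) \<omega> \<and> Q n \<omega> = (Y n \<omega>)\<^sup>2" for n
  proof -
    have "AE \<omega> in completion (P x). \<forall>k\<in>{..<Suc n}. real k * \<delta> n < r \<omega> \<longleftrightarrow> \<omega> \<in> B (real k * \<delta> n)"
      by (rule AE_finite_allI) (use B(2) grid in auto)
    then show ?thesis using AE_space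
    proof eventually_elim
      case (elim \<omega>)
      then have \<omega>: "\<omega> \<in> space M" by (simp add: space_P)
      have ind: "indicator (B (real k * \<delta> n)) \<omega> = (of_bool (real k * \<delta> n < r \<omega>) :: real)"
        if "k \<in> {..<Suc n}" for k
        using elim(1) that by (auto simp: indicator_def)
      have r_le: "0 \<le> r \<omega>" "r \<omega> \<le> \<delta> n * real (Suc n)" using r[OF \<omega>] \<delta>(2)[of n] by auto
      have "(\<Sum>k<Suc n. indicator (B (real k * \<delta> n)) \<omega> *
          (w (real (Suc k) * \<delta> n) - w (real k * \<delta> n))) = w (q n \<omega>) - w 0" for w :: "real \<Rightarrow> real"
      proof -
        have "(\<Sum>k<Suc n. indicator (B (real k * \<delta> n)) \<omega> *
            (w (real (Suc k) * \<delta> n) - w (real k * \<delta> n))) =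
          (\<Sum>k<Suc n. of_bool (real k * \<delta> n < r \<omega>) * (w (real (Suc k) * \<delta> n) - w (real k * \<delta> n)))"
          using ind by (intro sum.cong) auto
        also have "\<dots> = w (q n \<omega>) - w 0"
          unfolding q_def by (rule sum_telescope_of_bool[OF \<delta>(1) r_le, symmetric])
        finally show ?thesis .
      qed
      from this[of "\<lambda>t. W t \<omega>"] this[of "\<lambda>t. (W t \<omega>)\<^sup>2"] show ?case
        by (simp add: Y_def Q_def)
    qed
  qed
  have Y_int: "integrable (P x) (Y n)" and Y_exp: "(\<integral>\<omega>. Y n \<omega> \<partial>P x) = x"
    and Q_int: "integrable (P x) (Q n)" and Q_exp: "(\<integral>\<omega>. Q n \<omega> \<partial>P x) \<le> x\<^sup>2 + T" for n
  proof -
    note orth = increment_orthogonal[OF grid(1,3) B(1)[OF grid(1,2)], of _ n]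
    have sums: "integrable (P x) (\<lambda>\<omega>. \<Sum>k<Suc n. indicator (B (real k * \<delta> n)) \<omega> *
        (W (real (Suc k) * \<delta> n) \<omega> - W (real k * \<delta> n) \<omega>))"
      "integrable (P x) (\<lambda>\<omega>. \<Sum>k<Suc n. indicator (B (real k * \<delta> n)) \<omega> *
        ((W (real (Suc k) * \<delta> n) \<omega>)\<^sup>2 - (W (real k * \<delta> n) \<omega>)\<^sup>2))"
      by (intro Bochner_Integration.integrable_sum orth(1,3); simp)+
    show "integrable (P x) (Y n)" "integrable (P x) (Q n)"
      unfolding Y_def Q_def using sums by (intro Bochner_Integration.integrable_add W_integrable; simp)+
    have "(\<integral>\<omega>. Y n \<omega> \<partial>P x) = (\<integral>\<omega>. W 0 \<omega> \<partial>P x) + (\<Sum>k<Suc n. (\<integral>\<omega>. indicator (B (real k * \<delta> n)) \<omega> *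
      (W (real (Suc k) * \<delta> n) \<omega> - W (real k * \<delta> n) \<omega>) \<partial>P x))"
      unfolding Y_def
      by (subst Bochner_Integration.integral_add[OF W_integrable(1) sums(1)], simp,
          subst Bochner_Integration.integral_sum, rule orth(1), simp_all)
    also have "\<dots> = x" using orth(2) by (subst sum.neutral) (auto simp: expectation_W_0)
    finally show "(\<integral>\<omega>. Y n \<omega> \<partial>P x) = x" .
    have "(\<integral>\<omega>. Q n \<omega> \<partial>P x) = (\<integral>\<omega>. (W 0 \<omega>)\<^sup>2 \<partial>P x) + (\<Sum>k<Suc n. (\<integral>\<omega>. indicator (B (real k * \<delta> n)) \<omega> *
      ((W (real (Suc k) * \<delta> n) \<omega>)\<^sup>2 - (W (real k * \<delta> n) \<omega>)\<^sup>2) \<partial>P x))"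
      unfolding Q_def
      by (subst Bochner_Integration.integral_add[OF W_integrable(2) sums(2)], simp,
          subst Bochner_Integration.integral_sum, rule orth(3), simp_all)
    also have "\<dots> \<le> x\<^sup>2 + (\<Sum>k<Suc n. real (Suc k) * \<delta> n - real k * \<delta> n)"
      using orth(4) by (intro add_mono sum_mono) (auto simp: expectation_W_0)
    also have "(\<Sum>k<Suc n. real (Suc k) * \<delta> n - real k * \<delta> n) = T"
      using sum_lessThan_telescope[of "\<lambda>k. real k * \<delta> n" "Suc n"] \<delta>(2)[of n] by (simp add: mult.commute)
    finally show "(\<integral>\<omega>. Q n \<omega> \<partial>P x) \<le> x\<^sup>2 + T" by simp
  qed
  have Y_int': "integrable (completion (P x)) (Y n)" and Y_exp': "expect P x (Y n) = x"
    and Q_int': "integrable (completion (P x)) (Q n)" and Q_exp': "expect P x (Q n) \<le> x\<^sup>2 + T" for n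
    using Y_int[of n] Y_exp[of n] Q_int[of n] Q_exp[of n] borel_measurable_integrable
    by (auto simp: integrable_completion integral_completion)
  have near: "\<bar>x - expect P x (\<lambda>\<omega>. W (r \<omega>) \<omega>)\<bar> \<le> (x\<^sup>2 + T) / L" if L: "0 < L" "K \<le> L" for L
  proof -
    \<comment> \<open>Truncation at a level \<open>L\<close> at least \<open>K\<close> leaves the
      limit \<open>W (r \<omega>) \<omega>\<close> unchanged and permits dominated convergence; the
      error it causes for \<open>Y n\<close> is at most \<open>(x\<^sup>2 + T) / L\<close>, and
      \<open>L\<close> is sent to infinity at the end.\<close>
    define \<phi> where "\<phi> y = max (- L) (min L y)" for y :: real
    have \<phi>_meas [measurable]: "\<phi> \<in> borel_measurable borel" unfolding \<phi>_def by measurable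
    have \<phi>_le: "\<bar>\<phi> y\<bar> \<le> L" for y using L by (auto simp: \<phi>_def)
    have \<phi>_cont: "isCont \<phi> y" for y unfolding \<phi>_def by (intro continuous_intros)
    have Ym [measurable]: "Y n \<in> borel_measurable (completion (P x))" for n
      using Y_int' by (rule borel_measurable_integrable)
    have \<phi>Y_int: "integrable (completion (P x)) (\<lambda>\<omega>. \<phi> (Y n \<omega>))" for n
      by (rule C.integrable_const_bound[of _ L]) (use \<phi>_le in auto)
    have est: "\<bar>x - expect P x (\<lambda>\<omega>. \<phi> (Y n \<omega>))\<bar> \<le> (x\<^sup>2 + T) / L" for n
    proof -
      have "x - expect P x (\<lambda>\<omega>. \<phi> (Y n \<omega>)) = expect P x (\<lambda>\<omega>. Y n \<omega> - \<phi> (Y n \<omega>))"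
        using Y_int' \<phi>Y_int Y_exp' by simp
      then have "\<bar>x - expect P x (\<lambda>\<omega>. \<phi> (Y n \<omega>))\<bar> \<le> expect P x (\<lambda>\<omega>. \<bar>Y n \<omega> - \<phi> (Y n \<omega>)\<bar>)"
        by simp
      also have "\<dots> \<le> expect P x (\<lambda>\<omega>. Q n \<omega> / L)"
      proof (rule integral_mono_AE)
        show "AE \<omega> in completion (P x). \<bar>Y n \<omega> - \<phi> (Y n \<omega>)\<bar> \<le> Q n \<omega> / L"
          using Y_eq[of n] by eventually_elim (simp add: \<phi>_def abs_diff_truncation_le[OF L(1)])
      qed (use Y_int' \<phi>Y_int Q_int' in auto)
      also have "\<dots> \<le> (x\<^sup>2 + T) / L" using Q_exp' L by (simp add: divide_right_mono)
      finally show ?thesis .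
    qed
    have "(\<lambda>n. expect P x (\<lambda>\<omega>. \<phi> (Y n \<omega>))) \<longlonglongrightarrow> expect P x (\<lambda>\<omega>. W (r \<omega>) \<omega>)"
    proof (rule integral_dominated_convergence[where w="\<lambda>_. L"])
      have "AE \<omega> in completion (P x). \<forall>n. Y n \<omega> = W (q n \<omega>) \<omega>"
        using Y_eq by (auto simp: AE_all_countable elim: eventually_mono)
      then show "AE \<omega> in completion (P x). (\<lambda>n. \<phi> (Y n \<omega>)) \<longlonglongrightarrow> W (r \<omega>) \<omega>"
        using bounded AE_space
      proof eventually_elim
        case (elim \<omega>)
        then have \<omega>: "\<omega> \<in> space M" by (simp add: space_P)
        have q_lim: "(\<lambda>n. q n \<omega>) \<longlonglongrightarrow> r \<omega>"
          unfolding q_def \<delta>_def using r[OF \<omega>] T by (intro tendsto_ceiling_multiple) auto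
        have q_ev: "\<forall>\<^sub>F n in sequentially. q n \<omega> \<in> {0..}"
          unfolding atLeast_iff q_def
          by (intro always_eventually allI mult_nonneg_nonneg of_nat_0_le_iff less_imp_le[OF \<delta>(1)])
        have "(\<lambda>n. W (q n \<omega>) \<omega>) \<longlonglongrightarrow> W (r \<omega>) \<omega>"
          by (rule continuous_on_tendsto_compose[OF continuous_paths[OF \<omega>] q_lim _ q_ev])
            (use r[OF \<omega>] in simp)
        then have "(\<lambda>n. \<phi> (W (q n \<omega>) \<omega>)) \<longlonglongrightarrow> \<phi> (W (r \<omega>) \<omega>)"
          by (rule isCont_tendsto_compose[OF \<phi>_cont])
        moreover have "\<phi> (W (r \<omega>) \<omega>) = W (r \<omega>) \<omega>" using elim(2) L by (auto simp: \<phi>_def)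
        ultimately show ?case using elim(1) by simp
      qed
    qed (use meas \<phi>_le in auto)
    then have "(\<lambda>n. \<bar>x - expect P x (\<lambda>\<omega>. \<phi> (Y n \<omega>))\<bar>) \<longlonglongrightarrow> \<bar>x - expect P x (\<lambda>\<omega>. W (r \<omega>) \<omega>)\<bar>"
      by (intro tendsto_intros)
    then show ?thesis by (rule LIMSEQ_le_const2) (use est in auto)
  qed
  have lim: "((\<lambda>L. (x\<^sup>2 + T) / L) \<longlongrightarrow> 0) at_top"
    by (intro tendsto_divide_0[OF tendsto_const] filterlim_at_top_imp_at_infinity filterlim_ident)
  have "\<bar>x - expect P x (\<lambda>\<omega>. W (r \<omega>) \<omega>)\<bar> \<le> 0"
  proof (rule tendsto_lowerbound[OF lim])
    show "\<forall>\<^sub>F L in at_top. \<bar>x - expect P x (\<lambda>\<omega>. W (r \<omega>) \<omega>)\<bar> \<le> (x\<^sup>2 + T) / L"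
      using eventually_gt_at_top[of 0] eventually_ge_at_top[of K] by eventually_elim (rule near)
  qed simp
  then show ?thesis by simp
qed

text \<open>A path that never leaves keeps every increment \<open>W n - W 0\<close> in
  \<open>[-L,L]\<close>. The normal density at time \<open>n\<close> is at most
  \<open>1 / sqrt (2 * pi * n)\<close>, so this has probability of order \<open>1 / sqrt n\<close>.
  The absolute value in \<open>L\<close> covers empty intervals.\<close>

lemma AE_exit_from_finite: "AE \<omega> in completion (P x). exit_from W c d \<omega> < \<infinity>"
proof -
  interpret prob_space "P x" by (rule prob_space_P)
  have [measurable]: "\<And>t. 0 \<le> t \<Longrightarrow> W t \<in> borel_measurable (P x)" by (rule W_measurable_P)
  define L where "L = \<bar>d - c\<bar>"
  define S where "S n = {\<omega> \<in> space (P x). W (real (Suc n)) \<omega> - W 0 \<omega> \<in> {-L..L}}" for n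
  have S_meas: "S n \<in> sets (P x)" for n
    unfolding S_def by measurable
  have bound: "measure (P x) (S n) \<le> 2 * L / sqrt (2 * pi * real (Suc n))" for n
  proof -
    let ?t = "real (Suc n)"
    have D: "distributed (P x) lborel (\<lambda>\<omega>. W ?t \<omega> - W 0 \<omega>) (normal_density 0 (sqrt ?t))"
      using increment_normal[of 0 ?t x] by simp
    have "measure (P x) (S n) = (\<integral>y. normal_density 0 (sqrt ?t) y * indicator {-L..L} y \<partial>lborel)"
    proof -
      have "measure (P x) (S n) = (\<integral>\<omega>. indicator {-L..L} (W ?t \<omega> - W 0 \<omega>) \<partial>P x)"
      proof -
        have "(\<integral>\<omega>. indicator {-L..L} (W ?t \<omega> - W 0 \<omega>) \<partial>P x) = (\<integral>\<omega>. indicat_real (S n) \<omega> \<partial>P x)"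
          by (intro Bochner_Integration.integral_cong) (auto simp: S_def indicator_def)
        also have "\<dots> = measure (P x) (S n)"
          using S_meas[of n] by (simp add: Int_absorb2 sets.sets_into_space)
        finally show ?thesis by simp
      qed
      also have "\<dots> = (\<integral>y. normal_density 0 (sqrt ?t) y * indicator {-L..L} y \<partial>lborel)"
        by (rule distributed_integral[OF D, symmetric]) auto
      finally show ?thesis .
    qed
    also have "\<dots> \<le> (\<integral>y. (1 / sqrt (2 * pi * ?t)) * indicator {-L..L} y \<partial>lborel)"
    proof (rule integral_mono)
      show "integrable lborel (\<lambda>y. normal_density 0 (sqrt ?t) y * indicator {-L..L} y)"
        by (rule integrable_real_mult_indicator) auto
      show "integrable lborel (\<lambda>y. (1 / sqrt (2 * pi * ?t)) * indicator {-L..L} y)"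
        by (intro integrable_mult_right integrable_real_indicator) (auto simp: emeasure_lborel_Icc_eq)
      show "normal_density 0 (sqrt ?t) y * indicator {-L..L} y \<le> (1 / sqrt (2 * pi * ?t)) * indicator {-L..L} y" for y
        unfolding normal_density_def
        by (intro mult_right_mono) (auto intro!: divide_right_mono)
    qed
    also have "\<dots> = 2 * L / sqrt (2 * pi * ?t)" by (simp add: L_def)
    finally show ?thesis .
  qed
  have lim: "(\<lambda>n. 2 * L / sqrt (2 * pi * real (Suc n))) \<longlonglongrightarrow> 0"
    by real_asymp
  have "measure (P x) (\<Inter>n. S n) \<le> 0"
  proof (rule LIMSEQ_le_const[OF lim])
    have "measure (P x) (\<Inter>n. S n) \<le> measure (P x) (S n)" for n
      using S_meas by (intro finite_measure_mono) auto
    then show "\<exists>N. \<forall>n\<ge>N. measure (P x) (\<Inter>n. S n) \<le> 2 * L / sqrt (2 * pi * real (Suc n))"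
      using bound order_trans by blast
  qed
  then have "(\<Inter>n. S n) \<in> null_sets (P x)"
    using S_meas by (intro null_setsI) (auto simp: emeasure_eq_measure intro: antisym)
  then have "AE \<omega> in P x. \<omega> \<notin> (\<Inter>n. S n)" by (rule AE_not_in)
  then have "AE \<omega> in P x. exit_from W c d \<omega> < \<infinity>"
    using AE_space
  proof eventually_elim
    case (elim \<omega>)
    show ?case
    proof (rule ccontr)
      assume "\<not> ?case"
      then have inside: "W t \<omega> \<in> {c<..<d}" if "0 \<le> t" for t
        using before_exit_from[of t W c d \<omega>] that by (auto simp: less_top[symmetric])
      have "\<omega> \<in> S n" for n
      proof -
        have "c < W 0 \<omega>" "W 0 \<omega> < d" "c < W (real (Suc n)) \<omega>" "W (real (Suc n)) \<omega> < d"
          using inside[of 0] inside[of "real (Suc n)"] by auto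
        then have "W (real (Suc n)) \<omega> - W 0 \<omega> \<in> {-L..L}" unfolding L_def atLeastAtMost_iff by linarith
        then show ?thesis using elim(2) unfolding S_def by blast
      qed
      then show False using elim(1) by blast
    qed
  qed
  then show ?thesis by (rule AE_completion)
qed

end

text \<open>Holds without measurability, since the integral of a non-integrable function is 0 by
  convention; hence the hypothesis \<open>0 \<le> K\<close>. It lets payoffs be bounded for
  arbitrary times.\<close>

lemma (in prob_space) expectation_le_const:
  fixes X :: "'a \<Rightarrow> real"
  assumes "\<And>\<omega>. \<omega> \<in> space M \<Longrightarrow> \<bar>X \<omega>\<bar> \<le> K" "0 \<le> K"
  shows "expectation X \<le> K"
proof (cases "integrable M X")
  case True
  then show ?thesis using assms(1) by (intro integral_le_const AE_I2) (auto simp: abs_le_iff)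
qed (simp add: not_integrable_integral_eq assms(2))

context brownian_family
begin

text \<open>Up to the exit the path stays in \<open>[c,d]\<close>, so \<open>\<rho>\<close> may be
  cut off at \<open>n + 1\<close>, the bounded case applied, and \<open>n\<close> sent to infinity
  by dominated convergence. Where \<open>\<rho>\<close> is infinite, \<open>enn2real\<close> reads
  it as time 0, but this happens only on a null set.\<close>

lemma stopped_at_exit_from:
  assumes \<rho>: "stopping_time completed_filtration \<rho>"
    and le: "\<And>\<omega>. \<omega> \<in> space M \<Longrightarrow> \<rho> \<omega> \<le> exit_from W c d \<omega>" and x: "x \<in> {c..d}"
  shows "(\<lambda>\<omega>. W (enn2real (\<rho> \<omega>)) \<omega>) \<in> borel_measurable (completion (P x))" (is ?meas)
    and "AE \<omega> in completion (P x). W (enn2real (\<rho> \<omega>)) \<omega> \<in> {c..d}" (is ?bounded)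
    and "integrable (completion (P x)) (\<lambda>\<omega>. W (enn2real (\<rho> \<omega>)) \<omega>)" (is ?int)
    and "expect P x (\<lambda>\<omega>. W (enn2real (\<rho> \<omega>)) \<omega>) = x" (is ?exp)
proof -
  interpret C: prob_space "completion (P x)" by (rule prob_space_completion_P)
  have \<rho>_meas [measurable]: "\<rho> \<in> borel_measurable (completion (P x))"
    by (rule stopping_time_measurable[OF \<rho>])
  define r where "r n \<omega> = enn2real (min (\<rho> \<omega>) (ennreal (real (Suc n))))" for n \<omega>
  have r_eq: "ennreal (r n \<omega>) = min (\<rho> \<omega>) (ennreal (real (Suc n)))" for n \<omega>
    by (simp add: r_def min_less_iff_disj)
  have r_bounds: "0 \<le> r n \<omega>" "r n \<omega> \<le> real (Suc n)" "ennreal (r n \<omega>) \<le> \<rho> \<omega>" for n \<omega>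
  proof -
    show "0 \<le> r n \<omega>" by (simp add: r_def)
    show "ennreal (r n \<omega>) \<le> \<rho> \<omega>" unfolding r_eq by (rule min.cobounded1)
    have "ennreal (r n \<omega>) \<le> ennreal (real (Suc n))" unfolding r_eq by (rule min.cobounded2)
    then show "r n \<omega> \<le> real (Suc n)" by (simp only: ennreal_le_iff of_nat_0_le_iff)
  qed
  have r_less: "s < r n \<omega> \<longleftrightarrow> ennreal s < \<rho> \<omega>" if "0 \<le> s" "s < real (Suc n)" for s n \<omega>
  proof -
    have "s < r n \<omega> \<longleftrightarrow> ennreal s < ennreal (r n \<omega>)" using that by (simp add: ennreal_less_iff)
    also have "\<dots> \<longleftrightarrow> ennreal s < \<rho> \<omega> \<and> ennreal s < ennreal (real (Suc n))"
      unfolding r_eq by (rule min_less_iff_conj)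
    also have "\<dots> \<longleftrightarrow> ennreal s < \<rho> \<omega>"
      using that ennreal_less_iff[OF that(1), of "real (Suc n)"] by blast
    finally show ?thesis .
  qed
  have r_meas: "r n \<in> borel_measurable (completion (P x))" for n
    unfolding r_def by measurable
  show ?meas
    by (rule stopped_W_measurable) auto
  have fin: "AE \<omega> in completion (P x). \<rho> \<omega> < \<infinity>"
    using AE_exit_from_finite[of c d x] AE_start[of x]
    by eventually_elim (auto intro: order_le_less_trans[OF le])
  have in_cd: "W s \<omega> \<in> {c..d}" if "\<omega> \<in> space M" "W 0 \<omega> = x" "0 \<le> s" "ennreal s \<le> \<rho> \<omega>" for s \<omega>
    using until_exit_from[of W \<omega> c d s, OF continuous_paths] that x le[of \<omega>] by force
  show in_cd': ?bounded
    using AE_start[of x] fin by eventually_elim (rule in_cd, auto)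
  then have "AE \<omega> in completion (P x). norm (W (enn2real (\<rho> \<omega>)) \<omega>) \<le> \<bar>c\<bar> + \<bar>d\<bar>"
    by eventually_elim auto
  then show ?int
    using \<open>?meas\<close> by (rule C.integrable_const_bound)
  have E: "expect P x (\<lambda>\<omega>. W (r n \<omega>) \<omega>) = x" for n
  proof (rule expectation_stopped_bounded_time[where T="real (Suc n)" and K="\<bar>c\<bar> + \<bar>d\<bar>"])
    show "(\<lambda>\<omega>. W (r n \<omega>) \<omega>) \<in> borel_measurable (completion (P x))"
      by (rule stopped_W_measurable[OF r_meas r_bounds(1)])
    show "AE \<omega> in completion (P x). \<bar>W (r n \<omega>) \<omega>\<bar> \<le> \<bar>c\<bar> + \<bar>d\<bar>"
      using AE_start[of x]
    proof eventually_elim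
      case (elim \<omega>)
      then have "W (r n \<omega>) \<omega> \<in> {c..d}" by (intro in_cd) (auto simp: r_bounds)
      then show ?case by auto
    qed
    fix s :: real assume s: "0 \<le> s" "s < real (Suc n)"
    have "{\<omega> \<in> space M. ennreal s < \<rho> \<omega>} \<in> sets (completed_filtration (ennreal s))"
      using stopping_timeD2[OF \<rho>, of "ennreal s"]
      by (simp add: Measurable.pred_def space_completed_filtration)
    from completed_filtration_AE_eq[OF this, of x] obtain B where B: "B \<in> sets (G (ennreal s))"
      "AE \<omega> in completion (P x). \<omega> \<in> {\<omega> \<in> space M. ennreal s < \<rho> \<omega>} \<longleftrightarrow> \<omega> \<in> B" by blast
    have "AE \<omega> in completion (P x). s < r n \<omega> \<longleftrightarrow> \<omega> \<in> B"
      using B(2) AE_start[of x] by eventually_elim (simp add: r_less[OF s])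
    then show "\<exists>B\<in>sets (G (ennreal s)). AE \<omega> in completion (P x). s < r n \<omega> \<longleftrightarrow> \<omega> \<in> B"
      using B(1) by blast
  qed (use r_bounds in auto)
  have "(\<lambda>n. expect P x (\<lambda>\<omega>. W (r n \<omega>) \<omega>)) \<longlonglongrightarrow> expect P x (\<lambda>\<omega>. W (enn2real (\<rho> \<omega>)) \<omega>)"
  proof (rule integral_dominated_convergence[where w="\<lambda>_. \<bar>c\<bar> + \<bar>d\<bar>"])
    show "(\<lambda>\<omega>. W (r n \<omega>) \<omega>) \<in> borel_measurable (completion (P x))" for n
      by (rule stopped_W_measurable[OF r_meas r_bounds(1)])
    show "AE \<omega> in completion (P x). norm (W (r n \<omega>) \<omega>) \<le> \<bar>c\<bar> + \<bar>d\<bar>" for n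
      using AE_start[of x]
    proof eventually_elim
      case (elim \<omega>)
      then have "W (r n \<omega>) \<omega> \<in> {c..d}" by (intro in_cd) (auto simp: r_bounds)
      then show ?case by auto
    qed
    show "AE \<omega> in completion (P x). (\<lambda>n. W (r n \<omega>) \<omega>) \<longlonglongrightarrow> W (enn2real (\<rho> \<omega>)) \<omega>"
      using fin
    proof eventually_elim
      case (elim \<omega>)
      have "\<forall>\<^sub>F n in sequentially. r n \<omega> = enn2real (\<rho> \<omega>)"
        unfolding eventually_sequentially
      proof (intro exI[of _ "nat \<lceil>enn2real (\<rho> \<omega>)\<rceil>"] allI impI)
        fix n assume "nat \<lceil>enn2real (\<rho> \<omega>)\<rceil> \<le> n"
        then have "enn2real (\<rho> \<omega>) \<le> real (Suc n)" by linarith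
        then have "ennreal (enn2real (\<rho> \<omega>)) \<le> ennreal (real (Suc n))" by (rule ennreal_leI)
        then have "\<rho> \<omega> \<le> ennreal (real (Suc n))" using elim by simp
        then show "r n \<omega> = enn2real (\<rho> \<omega>)" unfolding r_def by (simp only: min_absorb1)
      qed
      then have "\<forall>\<^sub>F n in sequentially. W (r n \<omega>) \<omega> = W (enn2real (\<rho> \<omega>)) \<omega>"
        by eventually_elim simp
      then show ?case by (rule tendsto_eventually)
    qed
  qed (use \<open>?meas\<close> in auto)
  then show ?exp
    unfolding E by (simp add: LIMSEQ_const_iff)
qed

lemma expectation_affine_stopped:
  assumes "stopping_time completed_filtration \<rho>"
    and "\<And>\<omega>. \<omega> \<in> space M \<Longrightarrow> \<rho> \<omega> \<le> exit_from W c d \<omega>" and "x \<in> {c..d}"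
  shows "integrable (completion (P x)) (\<lambda>\<omega>. \<alpha> + \<beta> * W (enn2real (\<rho> \<omega>)) \<omega>)"
    and "expect P x (\<lambda>\<omega>. \<alpha> + \<beta> * W (enn2real (\<rho> \<omega>)) \<omega>) = \<alpha> + \<beta> * x"
proof -
  interpret C: prob_space "completion (P x)" by (rule prob_space_completion_P)
  note s = stopped_at_exit_from(3,4)[OF assms]
  show "integrable (completion (P x)) (\<lambda>\<omega>. \<alpha> + \<beta> * W (enn2real (\<rho> \<omega>)) \<omega>)"
    using s(1) by simp
  show "expect P x (\<lambda>\<omega>. \<alpha> + \<beta> * W (enn2real (\<rho> \<omega>)) \<omega>) = \<alpha> + \<beta> * x"
    using s C.prob_space by (simp add: space_P)
qed

text \<open>The indicator changes nothing for a living process, but turns \<open>f\<close>, which is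
  controlled on \<open>[0,1]\<close> only, into a Borel function on the whole line.\<close>

lemma ext0_killed_eq:
  "ext0 f (killed W t \<omega>) =
    (if t < exit_from W 0 1 \<omega> then indicator {0<..<1} (W (enn2real t) \<omega>) * f (W (enn2real t) \<omega>) else 0)"
proof (cases "t < exit_from W 0 1 \<omega>")
  case True
  then have "t < \<top>" by (rule order_less_le_trans) simp
  then have "W (enn2real t) \<omega> \<in> {0<..<1}" using True by (intro before_exit_from) auto
  then show ?thesis using True by (simp add: ext0_def killed_def exit_time_eq_exit_from)
qed (simp add: ext0_def killed_def exit_time_eq_exit_from)

lemma ext0_killed_measurable:
  fixes f :: "real \<Rightarrow> real"
  assumes f: "continuous_on {0..1} f" and \<tau> [measurable]: "\<tau> \<in> borel_measurable (completion (P x))"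
  shows "(\<lambda>\<omega>. ext0 f (killed W (\<tau> \<omega>) \<omega>)) \<in> borel_measurable (completion (P x))"
proof -
  have [measurable]: "(\<lambda>y. indicator {0<..<1} y * f y) \<in> borel_measurable borel"
    using borel_measurable_continuous_on_indicator[OF _ continuous_on_subset[OF f greaterThanLessThan_subseteq_atLeastAtMost_iff[THEN iffD2]], of 0 1]
    by simp
  have [measurable]: "(\<lambda>\<omega>. W (enn2real (\<tau> \<omega>)) \<omega>) \<in> borel_measurable (completion (P x))"
    by (rule stopped_W_measurable) auto
  have [measurable]: "exit_from W 0 1 \<in> borel_measurable (completion (P x))"
    by (rule stopping_time_measurable[OF stopping_time_exit_from])
  have "(\<lambda>\<omega>. (\<lambda>y. indicator {0<..<1} y * f y) (W (enn2real (\<tau> \<omega>)) \<omega>)) \<in> borel_measurable (completion (P x))"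
    by measurable
  then show ?thesis
    unfolding ext0_killed_eq by measurable
qed

lemma abs_ext0_killed_le:
  assumes "\<And>y. y \<in> {0..1} \<Longrightarrow> \<bar>f y\<bar> \<le> K" "0 \<le> K"
  shows "\<bar>ext0 f (killed W t \<omega>)\<bar> \<le> K"
  using assms by (auto simp: ext0_killed_eq indicator_def)

end

section \<open>Rewards under exit strategies\<close>

lemma continuous_on_Icc_abs_bounded:
  fixes f :: "real \<Rightarrow> real"
  assumes "continuous_on {a..b} f"
  obtains K where "0 \<le> K" "\<And>y. y \<in> {a..b} \<Longrightarrow> \<bar>f y\<bar> \<le> K"
proof -
  obtain K where "\<forall>y\<in>{a..b}. \<bar>f y\<bar> \<le> K"
    using compact_imp_bounded[OF compact_continuous_image[OF assms compact_Icc]] by (auto simp: bounded_iff)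
  then show thesis by (intro that[of "\<bar>K\<bar>"]) force+
qed

context brownian_family
begin

lemma exit_from_stopping_times: "exit_from W c d \<in> stopping_times completed_filtration"
  by (simp add: stopping_times_def stopping_time_exit_from)

definition response_reward ::
    "(real \<Rightarrow> real) \<Rightarrow> (real \<Rightarrow> real) \<Rightarrow> real \<Rightarrow> real \<Rightarrow> ('w \<Rightarrow> ennreal) \<Rightarrow> 'w \<Rightarrow> real" where
  "response_reward f g c d \<tau> \<omega> =
       ext0 f (killed W (\<tau> \<omega>) \<omega>) * of_bool (\<tau> \<omega> < exit_from W c d \<omega>)
     + ext0 g (killed W (exit_from W c d \<omega>) \<omega>) * of_bool (exit_from W c d \<omega> \<le> \<tau> \<omega>)"

lemma response_value_eq:
  assumes "{c<..<d} \<subseteq> {0<..<1}" "A \<inter> {0<..<1} = {0<..<1} - {c<..<d}"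
  shows "response_value P W completed_filtration f g A x =
    (SUP \<tau>\<in>stopping_times completed_filtration. expect P x (response_reward f g c d \<tau>))"
  unfolding response_value_def response_reward_def
  using hitting_time_eq_exit_from[of W _ c d A, OF continuous_paths assms]
  by (intro SUP_cong refl Bochner_Integration.integral_cong) (simp_all add: space_P)

lemma response_reward_integrable:
  assumes f: "continuous_on {0..1} f" and g: "continuous_on {0..1} g"
    and \<tau>: "\<tau> \<in> stopping_times completed_filtration"
  shows "integrable (completion (P x)) (response_reward f g c d \<tau>)"
proof -
  interpret C: prob_space "completion (P x)" by (rule prob_space_completion_P)
  have [measurable]: "\<tau> \<in> borel_measurable (completion (P x))"
    using \<tau> by (auto simp: stopping_times_def intro: stopping_time_measurable)
  have D [measurable]: "exit_from W c d \<in> borel_measurable (completion (P x))"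
    by (rule stopping_time_measurable[OF stopping_time_exit_from])
  have [measurable]: "(\<lambda>\<omega>. ext0 f (killed W (\<tau> \<omega>) \<omega>)) \<in> borel_measurable (completion (P x))"
    "(\<lambda>\<omega>. ext0 g (killed W (exit_from W c d \<omega>) \<omega>)) \<in> borel_measurable (completion (P x))"
    by (intro ext0_killed_measurable f g; measurable)+
  have meas: "response_reward f g c d \<tau> \<in> borel_measurable (completion (P x))"
    unfolding response_reward_def[abs_def] of_bool_def by measurable
  obtain K where K: "0 \<le> K" "\<And>y. y \<in> {0..1} \<Longrightarrow> \<bar>f y\<bar> \<le> K"
    using continuous_on_Icc_abs_bounded[OF f] by blast
  obtain L where L: "0 \<le> L" "\<And>y. y \<in> {0..1} \<Longrightarrow> \<bar>g y\<bar> \<le> L"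
    using continuous_on_Icc_abs_bounded[OF g] by blast
  have "norm (response_reward f g c d \<tau> \<omega>) \<le> K + L" for \<omega>
    using abs_ext0_killed_le[of f K, OF K(2,1), of "\<tau> \<omega>" \<omega>]
      abs_ext0_killed_le[of g L, OF L(2,1), of "exit_from W c d \<omega>" \<omega>] K(1) L(1)
    by (auto simp: response_reward_def)
  then show ?thesis
    using meas by (intro C.integrable_const_bound[of _ "K + L"]) auto
qed

text \<open>An exit through \<open>c\<close> or \<open>d\<close> inside (0,1) pays \<open>g\<close>
  there; an exit through 0 or 1 leads to the cemetery and pays 0, which is again the value of
  \<open>g\<close>. The cemetery thus disappears: the reward is a function of the stopped Brownian
  path in \<open>[c,d]\<close>.\<close>

lemma response_reward_AE:
  assumes cd: "0 \<le> c" "d \<le> 1" and x: "x \<in> {c..d}" and g0: "g 0 = 0" "g 1 = 0"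
  shows "AE \<omega> in completion (P x).
    let y = W (enn2real (min (\<tau> \<omega>) (exit_from W c d \<omega>))) \<omega> in
      y \<in> {c..d} \<and> (if \<tau> \<omega> < exit_from W c d \<omega> then response_reward f g c d \<tau> \<omega> = f y
        else y \<in> {c, d} \<and> response_reward f g c d \<tau> \<omega> = g y)"
  using AE_start[of x] AE_exit_from_finite[of c d x]
proof eventually_elim
  case (elim \<omega>)
  define D where "D = exit_from W c d \<omega>"
  have cont: "continuous_on {0..} (\<lambda>t. W t \<omega>)" using elim continuous_paths by blast
  have W0: "W 0 \<omega> \<in> {c..d}" using elim x by simp
  have Z: "D \<le> exit_from W 0 1 \<omega>" unfolding D_def using cd by (intro exit_from_mono) auto
  define y where "y = W (enn2real (min (\<tau> \<omega>) D)) \<omega>"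
  have "y \<in> {c..d}"
    unfolding y_def using elim
    by (intro until_exit_from[of W \<omega> c d, OF cont W0]) (auto simp: D_def[symmetric] min_less_iff_disj)
  moreover have "response_reward f g c d \<tau> \<omega> = f y" if "\<tau> \<omega> < D"
  proof -
    have "\<tau> \<omega> < exit_from W 0 1 \<omega>" using that Z by (rule order_less_le_trans)
    then show ?thesis using that
      by (simp add: response_reward_def D_def[symmetric] y_def killed_def exit_time_eq_exit_from ext0_def min_absorb1
        not_le[THEN iffD2, OF that])
  qed
  moreover have "y \<in> {c, d} \<and> response_reward f g c d \<tau> \<omega> = g y" if "\<not> \<tau> \<omega> < D"
  proof -
    have y: "y = W (enn2real D) \<omega>" using that by (simp add: y_def min_absorb2)
    have mem: "y \<in> {c, d}"
      unfolding y D_def by (rule at_exit_from[of W \<omega> c d, OF cont W0]) (use elim in simp)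
    moreover have "ext0 g (killed W D \<omega>) = g y"
    proof (cases "D < exit_from W 0 1 \<omega>")
      case True
      then show ?thesis by (simp add: y killed_def exit_time_eq_exit_from ext0_def)
    next
      case False
      then have "D = exit_from W 0 1 \<omega>" using Z by simp
      then have "y \<notin> {0<..<1}"
        using exit_from_notin[of W \<omega> 0 1, OF cont] elim y by (simp add: D_def)
      then have "y = 0 \<or> y = 1" using mem cd x by auto
      then show ?thesis using False g0 by (auto simp: killed_def exit_time_eq_exit_from ext0_def)
    qed
    ultimately show ?thesis
      using that not_less[THEN iffD1, OF that] by (simp add: response_reward_def D_def[symmetric])
  qed
  ultimately show ?case by (simp add: y_def D_def[symmetric] Let_def)
qed

lemma stopping_time_min_exit_from:
  assumes "\<tau> \<in> stopping_times completed_filtration"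
  shows "stopping_time completed_filtration (\<lambda>\<omega>. min (\<tau> \<omega>) (exit_from W c d \<omega>))"
  using assms by (auto simp: stopping_times_def intro!: stopping_time_min stopping_time_exit_from)

text \<open>The affine function dominates the reward pathwise at the time play ends, and optional
  stopping gives it mean \<open>\<alpha> + \<beta> * x\<close> there, whatever \<open>\<tau>\<close>
  is.\<close>

lemma response_reward_le_affine:
  assumes cd: "0 \<le> c" "d \<le> 1" and x: "x \<in> {c..d}" and g0: "g 0 = 0" "g 1 = 0"
    and f: "continuous_on {0..1} f" and g: "continuous_on {0..1} g"
    and maj: "\<And>y. y \<in> {c..d} \<Longrightarrow> f y \<le> \<alpha> + \<beta> * y" "g c \<le> \<alpha> + \<beta> * c" "g d \<le> \<alpha> + \<beta> * d"
    and \<tau>: "\<tau> \<in> stopping_times completed_filtration"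
  shows "expect P x (response_reward f g c d \<tau>) \<le> \<alpha> + \<beta> * x"
proof -
  let ?\<rho> = "\<lambda>\<omega>. min (\<tau> \<omega>) (exit_from W c d \<omega>)"
  note aff = expectation_affine_stopped[OF stopping_time_min_exit_from[OF \<tau>] min.cobounded2 x, of \<alpha> \<beta>]
  have "expect P x (response_reward f g c d \<tau>) \<le> expect P x (\<lambda>\<omega>. \<alpha> + \<beta> * W (enn2real (?\<rho> \<omega>)) \<omega>)"
  proof (rule integral_mono_AE)
    show "AE \<omega> in completion (P x). response_reward f g c d \<tau> \<omega> \<le> \<alpha> + \<beta> * W (enn2real (?\<rho> \<omega>)) \<omega>"
      using response_reward_AE[where f=f and \<tau>=\<tau>, OF cd x g0]
      by eventually_elim (use maj in \<open>auto simp: Let_def split: if_splits\<close>)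
  qed (use aff response_reward_integrable[OF f g \<tau>] in auto)
  then show ?thesis using aff by simp
qed

text \<open>A constant is an affine majorant. Boundedness gives the real supremum its usual meaning,
  so that single strategies bound it from below.\<close>

lemma response_reward_bdd_above:
  assumes "0 \<le> c" "d \<le> 1" and "x \<in> {c..d}" and "g 0 = 0" "g 1 = 0"
    and f: "continuous_on {0..1} f" and g: "continuous_on {0..1} g"
  shows "bdd_above ((\<lambda>\<tau>. expect P x (response_reward f g c d \<tau>)) ` stopping_times completed_filtration)"
proof -
  obtain K where K: "0 \<le> K" "\<And>y. y \<in> {0..1} \<Longrightarrow> \<bar>f y\<bar> \<le> K"
    using continuous_on_Icc_abs_bounded[OF f] by blast
  obtain L where L: "0 \<le> L" "\<And>y. y \<in> {0..1} \<Longrightarrow> \<bar>g y\<bar> \<le> L"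
    using continuous_on_Icc_abs_bounded[OF g] by blast
  have maj: "f y \<le> (K + L) + 0 * y" "g y \<le> (K + L) + 0 * y" if "y \<in> {c..d}" for y
    using K(2)[of y] L(2)[of y] K(1) L(1) that assms(1,2) by auto
  have "expect P x (response_reward f g c d \<tau>) \<le> (K + L) + 0 * x"
    if "\<tau> \<in> stopping_times completed_filtration" for \<tau>
    by (rule response_reward_le_affine[OF assms(1-5) f g _ _ _ that]) (use assms maj in auto)
  then show ?thesis by (intro bdd_aboveI2) blast
qed

lemma response_value_le_affine:
  assumes A: "{c<..<d} \<subseteq> {0<..<1}" "A \<inter> {0<..<1} = {0<..<1} - {c<..<d}"
    and cd: "0 \<le> c" "d \<le> 1" and x: "x \<in> {c..d}" and g0: "g 0 = 0" "g 1 = 0"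
    and f: "continuous_on {0..1} f" and g: "continuous_on {0..1} g"
    and maj: "\<And>y. y \<in> {c..d} \<Longrightarrow> f y \<le> \<alpha> + \<beta> * y" "g c \<le> \<alpha> + \<beta> * c" "g d \<le> \<alpha> + \<beta> * d"
  shows "response_value P W completed_filtration f g A x \<le> \<alpha> + \<beta> * x"
  unfolding response_value_eq[OF A]
  by (rule cSUP_least) (use exit_from_stopping_times response_reward_le_affine[OF cd x g0 f g maj] in auto)

text \<open>The strategy is to stop on leaving \<open>(p,q)\<close>. If an end of
  \<open>(p,q)\<close> is an end of \<open>(c,d)\<close>, the opponent stops there too and
  \<open>g\<close> is paid, which explains the case distinctions. The choice
  \<open>p = x = q\<close> is immediate stopping.\<close>

lemma response_value_ge_affine:
  assumes A: "{c<..<d} \<subseteq> {0<..<1}" "A \<inter> {0<..<1} = {0<..<1} - {c<..<d}"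
    and cd: "0 \<le> c" "d \<le> 1" and g0: "g 0 = 0" "g 1 = 0"
    and f: "continuous_on {0..1} f" and g: "continuous_on {0..1} g"
    and pq: "c \<le> p" "p \<le> x" "x \<le> q" "q \<le> d"
    and p: "\<alpha> + \<beta> * p \<le> (if c < p then f p else g c)"
    and q: "\<alpha> + \<beta> * q \<le> (if q < d then f q else g d)"
  shows "\<alpha> + \<beta> * x \<le> response_value P W completed_filtration f g A x"
proof -
  have x: "x \<in> {c..d}" and xpq: "x \<in> {p..q}" using pq by auto
  let ?\<tau> = "exit_from W p q"
  note aff = expectation_affine_stopped[OF stopping_time_exit_from order_refl xpq, of \<alpha> \<beta>]
  have le: "?\<tau> \<omega> \<le> exit_from W c d \<omega>" for \<omega> by (rule exit_from_mono) (use pq in auto)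
  have "expect P x (\<lambda>\<omega>. \<alpha> + \<beta> * W (enn2real (?\<tau> \<omega>)) \<omega>) \<le> expect P x (response_reward f g c d ?\<tau>)"
  proof (rule integral_mono_AE)
    show "AE \<omega> in completion (P x). \<alpha> + \<beta> * W (enn2real (?\<tau> \<omega>)) \<omega> \<le> response_reward f g c d ?\<tau> \<omega>"
      using response_reward_AE[where f=f and \<tau>="?\<tau>", OF cd x g0] AE_start[of x]
        AE_exit_from_finite[of p q x]
    proof eventually_elim
      case (elim \<omega>)
      let ?y = "W (enn2real (?\<tau> \<omega>)) \<omega>"
      have cont: "continuous_on {0..} (\<lambda>t. W t \<omega>)" using elim continuous_paths by blast
      have y: "?y \<in> {p, q}"
        by (rule at_exit_from[of W \<omega> p q, OF cont]) (use elim xpq in auto)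
      have reward: "if ?\<tau> \<omega> < exit_from W c d \<omega> then response_reward f g c d ?\<tau> \<omega> = f ?y
        else ?y \<in> {c, d} \<and> response_reward f g c d ?\<tau> \<omega> = g ?y"
        using elim(1) le[of \<omega>] by (auto simp: Let_def min_absorb1 split: if_splits)
      show ?case
      proof (cases "?\<tau> \<omega> < exit_from W c d \<omega>")
        case True
        \<comment> \<open>A path stopped before leaving \<open>(c,d)\<close> is strictly inside, so
          the end it has reached is one at which the hypotheses bound the line by
          \<open>f\<close>.\<close>
        then have "?y \<in> {c<..<d}"
          using elim by (intro before_exit_from) auto
        then show ?thesis using y reward True p q by (auto split: if_splits)
      next
        case False
        then show ?thesis using y reward p q pq by (auto split: if_splits)
      qed
    qed
  qed (use aff response_reward_integrable[OF f g exit_from_stopping_times] in auto)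
  also have "\<dots> \<le> response_value P W completed_filtration f g A x"
    unfolding response_value_eq[OF A]
    by (rule cSUP_upper[OF exit_from_stopping_times response_reward_bdd_above[OF cd x g0 f g]])
  finally show ?thesis using aff by simp
qed

lemma AE_killed_outside:
  assumes "x \<notin> {0<..<1}"
  shows "AE \<omega> in completion (P x). \<forall>t. killed W t \<omega> = None"
  using AE_start[of x]
proof eventually_elim
  case (elim \<omega>)
  then have "exit_from W 0 1 \<omega> = 0" using assms by (intro exit_from_start) auto
  then show ?case by (simp add: killed_def exit_time_eq_exit_from)
qed

text \<open>A process started at 0 or 1 is dead at once. This decides whether the boundary points
  belong to a response region, where optional stopping inside the interval says nothing.\<close>

lemma response_value_outside:
  assumes "x \<notin> {0<..<1}"
  shows "response_value P W completed_filtration f g A x = 0"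
proof -
  have "expect P x (\<lambda>\<omega>. ext0 f (killed W (\<tau> \<omega>) \<omega>) * of_bool (\<tau> \<omega> < hitting_time W A \<omega>)
     + ext0 g (killed W (hitting_time W A \<omega>) \<omega>) * of_bool (\<tau> \<omega> \<ge> hitting_time W A \<omega>)) = 0" for \<tau>
    by (rule integral_eq_zero_AE) (use AE_killed_outside[OF assms] in eventually_elim, simp add: ext0_def)
  then show ?thesis
    unfolding response_value_def using exit_from_stopping_times by (subst cSUP_const[symmetric]) auto
qed

section \<open>Payoffs of the Dynkin game when both players use exit times\<close>

definition game_reward ::
    "(real \<Rightarrow> real) \<Rightarrow> (real \<Rightarrow> real) \<Rightarrow> (real \<Rightarrow> real) \<Rightarrow> ('w \<Rightarrow> ennreal) \<Rightarrow> ('w \<Rightarrow> ennreal) \<Rightarrow> 'w \<Rightarrow> real" where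
  "game_reward f g h \<sigma> \<tau> \<omega> =
       ext0 f (killed W (\<sigma> \<omega>) \<omega>) * of_bool (\<sigma> \<omega> < \<tau> \<omega>)
     + ext0 g (killed W (\<tau> \<omega>) \<omega>) * of_bool (\<tau> \<omega> < \<sigma> \<omega>)
     + ext0 h (killed W (\<sigma> \<omega>) \<omega>) * of_bool (\<sigma> \<omega> = \<tau> \<omega>)"

lemma payoff_eq_expect: "payoff P W f g h x \<sigma> \<tau> = expect P x (game_reward f g h \<sigma> \<tau>)"
  unfolding payoff_def game_reward_def[abs_def] by (rule refl)

lemma game_reward_bounded:
  assumes "continuous_on {0..1} f" "continuous_on {0..1} g" "continuous_on {0..1} h"
  obtains K where "0 \<le> K" "\<And>\<sigma> \<tau> \<omega>. \<bar>game_reward f g h \<sigma> \<tau> \<omega>\<bar> \<le> K"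
proof -
  obtain K1 where K1: "0 \<le> K1" "\<And>y. y \<in> {0..1} \<Longrightarrow> \<bar>f y\<bar> \<le> K1"
    using continuous_on_Icc_abs_bounded[OF assms(1)] by blast
  obtain K2 where K2: "0 \<le> K2" "\<And>y. y \<in> {0..1} \<Longrightarrow> \<bar>g y\<bar> \<le> K2"
    using continuous_on_Icc_abs_bounded[OF assms(2)] by blast
  obtain K3 where K3: "0 \<le> K3" "\<And>y. y \<in> {0..1} \<Longrightarrow> \<bar>h y\<bar> \<le> K3"
    using continuous_on_Icc_abs_bounded[OF assms(3)] by blast
  have "\<bar>game_reward f g h \<sigma> \<tau> \<omega>\<bar> \<le> K1 + K2 + K3" for \<sigma> \<tau> \<omega>
    using abs_ext0_killed_le[of f K1, OF K1(2,1), of "\<sigma> \<omega>" \<omega>] K1(1)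
      abs_ext0_killed_le[of g K2, OF K2(2,1), of "\<tau> \<omega>" \<omega>] K2(1)
      abs_ext0_killed_le[of h K3, OF K3(2,1), of "\<sigma> \<omega>" \<omega>] K3(1)
    by (auto simp: game_reward_def)
  then show thesis using K1(1) K2(1) K3(1) by (intro that[of "K1 + K2 + K3"]) auto
qed

lemma game_reward_measurable:
  assumes f: "continuous_on {0..1} f" and g: "continuous_on {0..1} g" and h: "continuous_on {0..1} h"
  shows "game_reward f g h (exit_from W p q) (exit_from W c d) \<in> borel_measurable (completion (P x))"
proof -
  have exit_meas [measurable]: "exit_from W c d \<in> borel_measurable (completion (P x))" for c d
    by (rule stopping_time_measurable[OF stopping_time_exit_from])
  have [measurable]: "(\<lambda>\<omega>. ext0 f (killed W (exit_from W p q \<omega>) \<omega>)) \<in> borel_measurable (completion (P x))"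
    "(\<lambda>\<omega>. ext0 g (killed W (exit_from W c d \<omega>) \<omega>)) \<in> borel_measurable (completion (P x))"
    "(\<lambda>\<omega>. ext0 h (killed W (exit_from W p q \<omega>) \<omega>)) \<in> borel_measurable (completion (P x))"
    by (intro ext0_killed_measurable f g h exit_meas)+
  show ?thesis unfolding game_reward_def[abs_def] of_bool_def by measurable
qed

text \<open>Play ends on leaving the intersection of both intervals, and the end reached tells who
  stopped. Simultaneous stopping requires a common end; by assumption such an end is 0 or 1, where
  the process is dead and every reward vanishes. The reward is thus affine in the stopped path, and
  optional stopping evaluates it.\<close>

lemma payoff_exit_from_affine:
  assumes f: "continuous_on {0..1} f" and g: "continuous_on {0..1} g" and h: "continuous_on {0..1} h"
    and f0: "f 0 = 0" "f 1 = 0"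
    and pq: "0 \<le> p" "q \<le> 1" and cd: "0 \<le> c" "d \<le> 1"
    and x: "max p c < x" "x < min q d" and common: "p = c \<Longrightarrow> p = 0" "q = d \<Longrightarrow> q = 1"
    and lo: "\<alpha> + \<beta> * max p c = (if c \<le> p then f p else g c)"
    and hi: "\<alpha> + \<beta> * min q d = (if q \<le> d then f q else g d)"
  shows "payoff P W f g h x (exit_from W p q) (exit_from W c d) = \<alpha> + \<beta> * x"
proof -
  let ?\<sigma> = "exit_from W p q" and ?D = "exit_from W c d"
  let ?\<rho> = "exit_from W (max p c) (min q d)"
  have x': "x \<in> {max p c..min q d}" using x by simp
  note aff = expectation_affine_stopped[OF stopping_time_exit_from order_refl x', of \<alpha> \<beta>]
  have "expect P x (game_reward f g h ?\<sigma> ?D) = expect P x (\<lambda>\<omega>. \<alpha> + \<beta> * W (enn2real (?\<rho> \<omega>)) \<omega>)"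
  proof (rule integral_cong_AE)
    show "AE \<omega> in completion (P x). game_reward f g h ?\<sigma> ?D \<omega> = \<alpha> + \<beta> * W (enn2real (?\<rho> \<omega>)) \<omega>"
      using AE_start[of x] AE_exit_from_finite[of p q x] AE_exit_from_finite[of c d x]
    proof eventually_elim
      case (elim \<omega>)
      define y where "y = W (enn2real (?\<rho> \<omega>)) \<omega>"
      have \<rho>: "?\<rho> \<omega> = min (?\<sigma> \<omega>) (?D \<omega>)" by (rule exit_from_Int)
      have cont: "continuous_on {0..} (\<lambda>t. W t \<omega>)" using elim continuous_paths by blast
      have y: "y = max p c \<or> y = min q d"
        using at_exit_from[of W \<omega> "max p c" "min q d", OF cont] elim x' \<rho>
        by (auto simp: y_def min_less_iff_disj)
      have Z: "?\<sigma> \<omega> \<le> exit_from W 0 1 \<omega>" "?D \<omega> \<le> exit_from W 0 1 \<omega>"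
        using pq cd by (auto intro!: exit_from_mono)
      consider "?\<sigma> \<omega> < ?D \<omega>" | "?D \<omega> < ?\<sigma> \<omega>" | "?\<sigma> \<omega> = ?D \<omega>" by fastforce
      then show ?case
      proof cases
        case 1
        then have y\<sigma>: "y = W (enn2real (?\<sigma> \<omega>)) \<omega>" by (simp add: y_def \<rho> min_absorb1)
        have "y \<in> {c<..<d}"
          unfolding y\<sigma> using 1 elim by (intro before_exit_from) auto
        then have "f y = \<alpha> + \<beta> * y" using y lo hi x by (auto simp: max_def min_def split: if_splits)
        moreover have "killed W (?\<sigma> \<omega>) \<omega> = Some y"
          using order_less_le_trans[OF 1 Z(2)] by (simp add: killed_def exit_time_eq_exit_from y\<sigma>)
        ultimately show ?thesis
          using 1 less_not_sym[OF 1] less_imp_neq[OF 1] by (simp add: game_reward_def ext0_def y_def[symmetric])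
      next
        case 2
        then have yD: "y = W (enn2real (?D \<omega>)) \<omega>" by (simp add: y_def \<rho> min_absorb2)
        have "y \<in> {p<..<q}"
          unfolding yD using 2 elim by (intro before_exit_from) auto
        then have "g y = \<alpha> + \<beta> * y" using y lo hi x by (auto simp: max_def min_def split: if_splits)
        moreover have "killed W (?D \<omega>) \<omega> = Some y"
          using order_less_le_trans[OF 2 Z(1)] by (simp add: killed_def exit_time_eq_exit_from yD)
        ultimately show ?thesis
          using 2 less_not_sym[OF 2] less_imp_neq[OF 2, symmetric] by (simp add: game_reward_def ext0_def y_def[symmetric])
      next
        case 3
        then have y\<sigma>: "y = W (enn2real (?\<sigma> \<omega>)) \<omega>" "y = W (enn2real (?D \<omega>)) \<omega>" by (simp_all add: y_def \<rho>)
        have "y \<notin> {p<..<q}" "y \<notin> {c<..<d}"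
          using exit_from_notin[of W \<omega> p q, OF cont] exit_from_notin[of W \<omega> c d, OF cont] elim
          by (simp_all add: y\<sigma>[symmetric])
        \<comment> \<open>The reached end lies outside both intervals although \<open>x\<close> lies
          inside both, so it is an end of both and \<open>common\<close> applies.\<close>
        then have y01: "y = 0 \<and> \<alpha> + \<beta> * y = f 0 \<or> y = 1 \<and> \<alpha> + \<beta> * y = f 1"
          using y lo hi x common by (auto simp: max_def min_def split: if_splits)
        have "\<not> ?\<sigma> \<omega> < exit_from W 0 1 \<omega>"
        proof
          assume "?\<sigma> \<omega> < exit_from W 0 1 \<omega>"
          then have "y \<in> {0<..<1}" unfolding y\<sigma>(1) using elim by (intro before_exit_from) auto
          then show False using y01 by auto
        qed
        then show ?thesis
          using 3 y01 f0 by (auto simp: game_reward_def ext0_def killed_def exit_time_eq_exit_from y_def[symmetric])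
      qed
    qed
  qed (use aff game_reward_measurable[OF f g h] in auto)
  then show ?thesis using aff by (simp add: payoff_eq_expect)
qed

lemma payoff_stop_at_once:
  assumes f: "continuous_on {0..1} f" and g: "continuous_on {0..1} g" and h: "continuous_on {0..1} h"
    and cd: "0 \<le> c" "d \<le> 1" "x \<in> {c<..<d}" and x: "x \<notin> {p<..<q}"
  shows "payoff P W f g h x (exit_from W p q) (exit_from W c d) = f x"
proof -
  interpret C: prob_space "completion (P x)" by (rule prob_space_completion_P)
  have "expect P x (game_reward f g h (exit_from W p q) (exit_from W c d)) = expect P x (\<lambda>\<omega>. f x)"
  proof (rule integral_cong_AE)
    show "AE \<omega> in completion (P x). game_reward f g h (exit_from W p q) (exit_from W c d) \<omega> = f x"
      using AE_start[of x]
    proof eventually_elim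
      case (elim \<omega>)
      have cont: "continuous_on {0..} (\<lambda>t. W t \<omega>)" using elim continuous_paths by blast
      have \<sigma>: "exit_from W p q \<omega> = 0" using elim x by (intro exit_from_start) auto
      have "exit_from W c d \<omega> \<noteq> 0"
        using exit_from_notin[of W \<omega> c d, OF cont] elim cd by auto
      moreover have "exit_from W 0 1 \<omega> \<noteq> 0"
        using exit_from_notin[of W \<omega> 0 1, OF cont] elim cd by auto
      ultimately show ?case
        using elim \<sigma> by (simp add: game_reward_def killed_def exit_time_eq_exit_from ext0_def zero_less_iff_neq_zero)
    qed
  qed (use game_reward_measurable[OF f g h] in auto)
  also have "\<dots> = f x" using C.prob_space by (simp add: space_P)
  finally show ?thesis by (simp add: payoff_eq_expect)
qed

text \<open>Without a bound the supremum in \<open>dp_solution\<close> would not dominate the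
  payoffs of deviations.\<close>

lemma payoff_bdd_above:
  assumes "continuous_on {0..1} f" "continuous_on {0..1} g" "continuous_on {0..1} h"
  shows "bdd_above ((\<lambda>\<sigma>. payoff P W f g h x \<sigma> \<tau>) ` S)"
proof -
  interpret C: prob_space "completion (P x)" by (rule prob_space_completion_P)
  obtain K where K: "0 \<le> K" "\<And>\<sigma> \<tau> \<omega>. \<bar>game_reward f g h \<sigma> \<tau> \<omega>\<bar> \<le> K"
    by (rule game_reward_bounded[OF assms]) blast
  have "payoff P W f g h x \<sigma> \<tau> \<le> K" for \<sigma>
    using C.expectation_le_const[of "game_reward f g h \<sigma> \<tau>" K] K by (simp add: payoff_eq_expect)
  then show ?thesis by (intro bdd_aboveI2)
qed

end

section \<open>Alternating minimisation of the slope\<close>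

lemma strictly_convex_on_imp_convex_on:
  assumes "strictly_convex_on S f" shows "convex_on S f"
proof (rule convex_onI)
  fix t x y :: real assume t: "0 < t" "t < 1" and xy: "x \<in> S" "y \<in> S"
  show "f ((1 - t) *\<^sub>R x + t *\<^sub>R y) \<le> (1 - t) * f x + t * f y"
  proof (cases "x = y")
    case True
    then show ?thesis by (simp add: algebra_simps)
  next
    case False
    have "\<forall>u>0. \<forall>v>0. x \<noteq> y \<and> u + v = 1 \<longrightarrow> f (u * x + v * y) < u * f x + v * f y"
      using assms xy unfolding strictly_convex_on_def by blast
    from this[rule_format, of "1 - t" t] show ?thesis using t False by simp
  qed
qed (use assms in \<open>simp add: strictly_convex_on_def\<close>)

lemma strictly_convex_on_less_chord:
  assumes f: "strictly_convex_on S f" and S: "p \<in> S" "q \<in> S" and x: "p < x" "x < q"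
    and le: "f p \<le> \<alpha> + \<beta> * p" "f q \<le> \<alpha> + \<beta> * q"
  shows "f x < \<alpha> + \<beta> * x"
proof -
  define u v where "u = (q - x) / (q - p)" and "v = (x - p) / (q - p)"
  have uv: "0 < u" "0 < v" "u + v = 1"
    using x by (auto simp: u_def v_def diff_divide_distrib[symmetric] add_divide_distrib[symmetric])
  have xeq: "x = u * p + v * q"
  proof -
    have "u * p + v * q = ((q - x) * p + (x - p) * q) / (q - p)" by (simp add: u_def v_def add_divide_distrib)
    also have "(q - x) * p + (x - p) * q = x * (q - p)" by (simp add: algebra_simps)
    finally show ?thesis using x by simp
  qed
  have "f (u * p + v * q) < u * f p + v * f q"
    using f S uv x unfolding strictly_convex_on_def by force
  also have "\<dots> \<le> u * (\<alpha> + \<beta> * p) + v * (\<alpha> + \<beta> * q)"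
    using uv le by (intro add_mono mult_left_mono) auto
  also have "\<dots> = (u + v) * \<alpha> + \<beta> * (u * p + v * q)" by (simp add: algebra_simps)
  finally show ?thesis using uv xeq by simp
qed

text \<open>The slope is a supergradient, obtained from a one-sided infimum of difference quotients
  of \<open>- f\<close>. It is available at interior points only.\<close>

lemma strictly_concave_on_support_line:
  assumes "strictly_concave_on {u..v} f" and x: "u < x" "x < v"
  obtains \<beta> where "\<And>y. y \<in> {u..v} \<Longrightarrow> f y \<le> f x + \<beta> * (y - x)"
proof -
  have "convex_on {u..v} (\<lambda>y. - f y)"
    using assms(1) by (intro strictly_convex_on_imp_convex_on) (simp add: strictly_concave_on_def)
  then have "- f y \<ge> - f x + Inf ((\<lambda>t. (- f x - - f t) / (x - t)) ` ({x<..} \<inter> {u..v})) * (y - x)"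
    if "y \<in> {u..v}" for y
    by (rule convex_le_Inf_differential) (use x that in \<open>auto simp: interior_atLeastAtMost_real\<close>)
  from this show thesis
    by (intro that[of "- Inf ((\<lambda>t. (- f x - - f t) / (x - t)) ` ({x<..} \<inter> {u..v}))"]) fastforce
qed

text \<open>If two points attain the least ratio \<open>s\<close>, then \<open>\<phi>\<close> meets
  the line \<open>s * (\<delta> + \<epsilon> * y) - z\<close> at both and lies strictly below it at
  their midpoint, where the ratio would be less than \<open>s\<close>. With
  \<open>\<delta> = - x\<close>, \<open>\<epsilon> = 1\<close> or \<open>\<delta> = y\<close>,
  \<open>\<epsilon> = - 1\<close> the ratio is the slope as a function of one of its
  variables.\<close>

lemma convex_ratio_unique_minimiser:
  fixes \<phi> :: "real \<Rightarrow> real"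
  assumes conv: "strictly_convex_on {u..v} \<phi>" and cont: "continuous_on {u..v} \<phi>" and uv: "u \<le> v"
    and pos: "\<And>y. y \<in> {u..v} \<Longrightarrow> 0 < \<delta> + \<epsilon> * y"
  shows "\<exists>r\<in>{u..v}. \<forall>y\<in>{u..v}. y \<noteq> r \<longrightarrow> (\<phi> r + z) / (\<delta> + \<epsilon> * r) < (\<phi> y + z) / (\<delta> + \<epsilon> * y)"
proof -
  let ?R = "\<lambda>y. (\<phi> y + z) / (\<delta> + \<epsilon> * y)"
  have "continuous_on {u..v} ?R"
    using pos by (intro continuous_intros cont) force
  then obtain r where r: "r \<in> {u..v}" "\<And>y. y \<in> {u..v} \<Longrightarrow> ?R r \<le> ?R y"
    using continuous_attains_inf[OF compact_Icc, of u v ?R] uv by auto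
  have less: "?R r < ?R y" if y: "y \<in> {u..v}" "y \<noteq> r" for y
  proof (rule ccontr)
    assume "\<not> ?R r < ?R y"
    then have "?R y \<le> ?R r" by simp
    define s where "s = ?R r"
    define m where "m = (min r y + max r y) / 2"
    have m: "m \<in> {u..v}" "min r y < m" "m < max r y" using r(1) y by (auto simp: m_def min_def max_def)
    have le: "\<phi> w \<le> (s * \<delta> - z) + (s * \<epsilon>) * w" if "w = r \<or> w = y" for w
    proof -
      have "?R w \<le> s" "0 < \<delta> + \<epsilon> * w" using that \<open>?R y \<le> ?R r\<close> pos r(1) y by (auto simp: s_def)
      then show ?thesis by (simp add: pos_divide_le_eq algebra_simps)
    qed
    have "\<phi> m < (s * \<delta> - z) + (s * \<epsilon>) * m"
      by (rule strictly_convex_on_less_chord[OF conv _ _ m(2,3)])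
        (use r(1) y in \<open>auto intro!: le simp: min_def max_def\<close>)
    then have "?R m < s" using pos[OF m(1)] by (simp add: pos_divide_less_eq algebra_simps)
    then show False using r(2)[OF m(1)] by (simp add: s_def)
  qed
  then show ?thesis using r(1) by blast
qed

text \<open>The values of \<open>S\<close> decrease along the iteration, so by compactness every
  subsequential limit is a coordinatewise minimum, and \<open>unique\<close> leaves only one
  candidate.\<close>

lemma alternating_minimisation_tendsto:
  fixes S :: "real \<Rightarrow> real \<Rightarrow> real"
  assumes K: "compact K1" "compact K2"
    and cont: "continuous_on (K1 \<times> K2) (\<lambda>p. S (fst p) (snd p))"
    and x: "\<And>n. x n \<in> K1" and y: "\<And>n. y n \<in> K2"
    and min_y: "\<And>n y'. y' \<in> K2 \<Longrightarrow> S (x n) (y n) \<le> S (x n) y'"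
    and min_x: "\<And>n x'. x' \<in> K1 \<Longrightarrow> S (x (Suc n)) (y n) \<le> S x' (y n)"
    and unique: "\<And>x' y'. \<lbrakk>x' \<in> K1; y' \<in> K2; \<And>y''. y'' \<in> K2 \<Longrightarrow> S x' y' \<le> S x' y'';
      \<And>x''. x'' \<in> K1 \<Longrightarrow> S x' y' \<le> S x'' y'\<rbrakk> \<Longrightarrow> x' = l \<and> y' = r"
  shows "x \<longlonglongrightarrow> l" "y \<longlonglongrightarrow> r"
proof -
  have S_lim: "(\<lambda>k. S (u k) (v k)) \<longlonglongrightarrow> S u' v'"
    if "u \<longlonglongrightarrow> u'" "v \<longlonglongrightarrow> v'" "\<And>k. u k \<in> K1" "\<And>k. v k \<in> K2" "u' \<in> K1" "v' \<in> K2" for u v u' v'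
    using continuous_on_tendsto_compose[OF cont tendsto_Pair[OF that(1,2)]] that(3-6) by simp
  have "(\<lambda>n. (x n, y n)) \<longlonglongrightarrow> (l, r)"
  proof (rule ccontr)
    assume "\<not> (\<lambda>n. (x n, y n)) \<longlonglongrightarrow> (l, r)"
    then obtain e where e: "0 < e" "\<And>N. \<exists>n\<ge>N. e \<le> dist (x n, y n) (l, r)"
      by (auto simp: lim_sequentially not_less)
    then have "infinite {n. e \<le> dist (x n, y n) (l, r)}"
      unfolding infinite_nat_iff_unbounded_le by auto
    then obtain s :: "nat \<Rightarrow> nat" where s: "strict_mono s" "\<And>k. e \<le> dist (x (s k), y (s k)) (l, r)"
      using infinite_enumerate by blast
    \<comment> \<open>The successor of \<open>x\<close> is tracked as well: \<open>x n\<close> need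
      not be a minimiser against \<open>y n\<close>, whereas \<open>x (Suc n)\<close> is, and so is
      its limit \<open>w\<close> against \<open>y'\<close>.\<close>
    have "compact (K1 \<times> K2 \<times> K1)" using K by (intro compact_Times)
    moreover have "\<forall>k. (x (s k), y (s k), x (Suc (s k))) \<in> K1 \<times> K2 \<times> K1" using x y by simp
    ultimately obtain p t where p: "p \<in> K1 \<times> K2 \<times> K1" and t: "strict_mono t"
      and lim: "((\<lambda>k. (x (s k), y (s k), x (Suc (s k)))) \<circ> t) \<longlonglongrightarrow> p"
      unfolding compact_def by meson
    define q where "q = s \<circ> t"
    have q: "strict_mono q" unfolding q_def by (rule strict_mono_o[OF s(1) t])
    define x' y' w where "x' = fst p" and "y' = fst (snd p)" and "w = snd (snd p)"
    have mem: "x' \<in> K1" "y' \<in> K2" "w \<in> K1" using p by (auto simp: x'_def y'_def w_def)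
    have lims: "(\<lambda>k. x (q k)) \<longlonglongrightarrow> x'" "(\<lambda>k. y (q k)) \<longlonglongrightarrow> y'" "(\<lambda>k. x (Suc (q k))) \<longlonglongrightarrow> w"
      using tendsto_fst[OF lim] tendsto_fst[OF tendsto_snd[OF lim]] tendsto_snd[OF tendsto_snd[OF lim]]
      by (simp_all add: q_def x'_def y'_def w_def comp_def)
    define T where "T n = S (x n) (y n)" for n
    have T_step: "T (Suc n) \<le> S (x (Suc n)) (y n)" "S (x (Suc n)) (y n) \<le> T n" for n
      using min_y[OF y] min_x[OF x] by (simp_all add: T_def)
    have T_dec: "decseq T" using T_step order_trans by (intro decseq_SucI) blast
    have T_lim: "(\<lambda>k. T (q k)) \<longlonglongrightarrow> S x' y'"
      unfolding T_def by (rule S_lim) (use lims mem x y in auto)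
    have mid_lim: "(\<lambda>k. S (x (Suc (q k))) (y (q k))) \<longlonglongrightarrow> S w y'"
      by (rule S_lim) (use lims mem x y in auto)
    \<comment> \<open>The half-step values lie between consecutive terms of the monotone
      \<open>T\<close>, which have the same limit along \<open>q\<close>. So \<open>w\<close> and
      \<open>x'\<close> give the same value against \<open>y'\<close>, and the minimality of
      \<open>w\<close> passes to \<open>x'\<close>.\<close>
    have "(\<lambda>k. S (x (Suc (q k))) (y (q k))) \<longlonglongrightarrow> S x' y'"
    proof (rule tendsto_sandwich[OF _ _ LIMSEQ_Suc[OF T_lim] T_lim])
      have "T (q (Suc k)) \<le> S (x (Suc (q k))) (y (q k))" for k
      proof -
        have "Suc (q k) \<le> q (Suc k)" using q by (simp add: strict_mono_Suc_iff Suc_leI)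
        then have "T (q (Suc k)) \<le> T (Suc (q k))" by (rule decseqD[OF T_dec])
        then show ?thesis using T_step(1)[of "q k"] by simp
      qed
      then show "\<forall>\<^sub>F k in sequentially. T (q (Suc k)) \<le> S (x (Suc (q k))) (y (q k))" by simp
    qed (simp add: T_step)
    then have eq: "S w y' = S x' y'" using mid_lim LIMSEQ_unique by blast
    have "x' = l \<and> y' = r"
    proof (rule unique[OF mem(1,2)])
      fix y'' assume y'': "y'' \<in> K2"
      have "(\<lambda>k. S (x (q k)) y'') \<longlonglongrightarrow> S x' y''"
        by (rule S_lim) (use lims mem x y'' in auto)
      then show "S x' y' \<le> S x' y''"
        by (rule LIMSEQ_le[OF T_lim]) (use min_y[OF y''] in \<open>auto simp: T_def\<close>)
    next
      fix x'' assume x'': "x'' \<in> K1"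
      have "(\<lambda>k. S x'' (y (q k))) \<longlonglongrightarrow> S x'' y'"
        by (rule S_lim) (use lims mem y x'' in auto)
      then show "S x' y' \<le> S x'' y'"
        unfolding eq[symmetric] by (rule LIMSEQ_le[OF mid_lim]) (use min_x[OF x''] in auto)
    qed
    moreover have "(\<lambda>k. dist (x (q k), y (q k)) (l, r)) \<longlonglongrightarrow> dist (x', y') (l, r)"
      using lims by (intro tendsto_intros)
    ultimately have "(\<lambda>k. dist (x (q k), y (q k)) (l, r)) \<longlonglongrightarrow> 0" by simp
    moreover have "e \<le> dist (x (q k), y (q k)) (l, r)" for k using s(2)[of "t k"] by (simp add: q_def)
    ultimately have "e \<le> 0" by (intro LIMSEQ_le_const) auto
    then show False using e(1) by simp
  qed
  from tendsto_fst[OF this] tendsto_snd[OF this] show "x \<longlonglongrightarrow> l" "y \<longlonglongrightarrow> r" by simp_all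
qed

text \<open>A coordinatewise minimum of the slope is a common tangent of the two graphs, hence a global minimum.\<close>

lemma coordinatewise_minimum_slope_unique:
  fixes f g :: "real \<Rightarrow> real"
  defines "S \<equiv> \<lambda>x y. (g y - f x) / (y - x)"
  assumes less: "\<And>x y. x \<in> K1 \<Longrightarrow> y \<in> K2 \<Longrightarrow> x < y"
    and mem: "x \<in> K1" "y \<in> K2" "l \<in> K1" "r \<in> K2"
    and min_xy: "\<And>y'. y' \<in> K2 \<Longrightarrow> S x y \<le> S x y'" "\<And>x'. x' \<in> K1 \<Longrightarrow> S x y \<le> S x' y"
    and min_lr: "\<And>y'. y' \<in> K2 \<Longrightarrow> y' \<noteq> r \<Longrightarrow> S l r < S l y'" "\<And>x'. x' \<in> K1 \<Longrightarrow> x' \<noteq> l \<Longrightarrow> S l r < S x' r"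
  shows "x = l \<and> y = r"
proof -
  \<comment> \<open>Tilting by \<open>s\<close> separates the variables: comparing \<open>S\<close>
    with \<open>s\<close> compares \<open>f - s * id\<close> at one point with
    \<open>g - s * id\<close> at the other. At a coordinatewise minimum of slope \<open>s\<close>
    the two tilted values agree, being a maximum of the first function and a minimum of the
    second.\<close>
  have le_iff: "s \<le> S x' y' \<longleftrightarrow> f x' - s * x' \<le> g y' - s * y'" if "x' \<in> K1" "y' \<in> K2" for s x' y'
    using less[OF that] by (auto simp: S_def pos_le_divide_eq algebra_simps)
  have eq_iff: "S x' y' = s \<longleftrightarrow> f x' - s * x' = g y' - s * y'" if "x' \<in> K1" "y' \<in> K2" for s x' y'
    using less[OF that] by (auto simp: S_def divide_eq_eq algebra_simps)
  have global: "S x0 y0 \<le> S x' y'"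
    if "x0 \<in> K1" "y0 \<in> K2" "x' \<in> K1" "y' \<in> K2"
      "\<And>y'. y' \<in> K2 \<Longrightarrow> S x0 y0 \<le> S x0 y'" "\<And>x'. x' \<in> K1 \<Longrightarrow> S x0 y0 \<le> S x' y0" for x0 y0 x' y'
  proof -
    let ?s = "S x0 y0"
    have "f x' - ?s * x' \<le> g y0 - ?s * y0" using that by (simp add: le_iff[symmetric])
    also have "\<dots> = f x0 - ?s * x0" using eq_iff[of x0 y0 ?s] that by simp
    also have "\<dots> \<le> g y' - ?s * y'" using that by (simp add: le_iff[symmetric])
    finally show ?thesis using that by (simp add: le_iff)
  qed
  have min_lr': "S l r \<le> S l y'" "S l r \<le> S x' r" if "x' \<in> K1" "y' \<in> K2" for x' y'
    using min_lr(1)[of y'] min_lr(2)[of x'] that by (cases "y' = r"; cases "x' = l"; force)+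
  define s where "s = S l r"
  have "S x y = s"
    using global[of l r x y] global[of x y l r] mem min_lr' min_xy unfolding s_def by (meson antisym)
  then have "f x - s * x = g y - s * y" "f l - s * l = g r - s * r"
    using eq_iff[of x y s] eq_iff[of l r s] mem by (simp_all add: s_def)
  moreover have "f l - s * l \<le> g y - s * y" "f x - s * x \<le> g r - s * r"
    using min_lr'(1)[of x y] min_lr'(2)[of x y] mem by (simp_all add: le_iff[symmetric] s_def)
  \<comment> \<open>The tilted values at \<open>l\<close>, \<open>y\<close>, \<open>x\<close> and
    \<open>r\<close> bound each other in a cycle and are all equal. So \<open>y\<close> is as good
    as \<open>r\<close> against \<open>l\<close>, and \<open>x\<close> as good as \<open>l\<close>
    against \<open>r\<close>; strictness at \<open>(l, r)\<close> finishes.\<close>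
  ultimately have "S l y = s" "S x r = s" using mem by (simp_all add: eq_iff)
  then show ?thesis using min_lr(1)[of y] min_lr(2)[of x] mem by (auto simp: s_def)
qed

section \<open>Painleve-Kuratowski limits of intervals\<close>

lemma pk_limI:
  fixes L :: "'a :: topological_space set"
  assumes sub: "\<And>z. z \<in> L \<Longrightarrow> \<exists>p. (\<forall>n. p n \<in> A n) \<and> p \<longlonglongrightarrow> z"
    and out: "\<And>z. z \<notin> L \<Longrightarrow> \<exists>U. open U \<and> z \<in> U \<and> (\<forall>\<^sub>F n in sequentially. U \<inter> A n = {})"
  shows "pk_liminf A = L \<and> pk_limsup A = L"
proof -
  have "L \<subseteq> pk_liminf A"
  proof
    fix z assume "z \<in> L"
    from sub[OF this] obtain p where p: "\<And>n. p n \<in> A n" "p \<longlonglongrightarrow> z" by blast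
    have "\<forall>\<^sub>F n in sequentially. U \<inter> A n \<noteq> {}" if "open U" "z \<in> U" for U
      using topological_tendstoD[OF p(2) that] by eventually_elim (use p(1) in blast)
    then show "z \<in> pk_liminf A" by (auto simp: pk_liminf_def)
  qed
  moreover have "pk_liminf A \<subseteq> pk_limsup A"
    unfolding pk_liminf_def pk_limsup_def by (auto intro: eventually_frequently)
  moreover have "pk_limsup A \<subseteq> L"
  proof
    fix z assume z: "z \<in> pk_limsup A"
    show "z \<in> L"
    proof (rule ccontr)
      assume "z \<notin> L"
      from out[OF this] obtain U where U: "open U" "z \<in> U" "\<forall>\<^sub>F n in sequentially. U \<inter> A n = {}" by blast
      then have "\<exists>\<^sub>F n in sequentially. U \<inter> A n \<noteq> {}" using z by (simp add: pk_limsup_def)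
      then show False using U(3) by (simp add: frequently_def)
    qed
  qed
  ultimately show ?thesis by blast
qed

lemma pk_lim_Icc:
  fixes x y :: "nat \<Rightarrow> real"
  assumes lim: "x \<longlonglongrightarrow> l" "y \<longlonglongrightarrow> r" and le: "\<And>n. x n \<le> y n"
  shows "pk_liminf (\<lambda>n. {x n..y n}) = {l..r} \<and> pk_limsup (\<lambda>n. {x n..y n}) = {l..r}"
proof (rule pk_limI)
  fix z assume z: "z \<in> {l..r}"
  \<comment> \<open>The approximating points are the projections of \<open>z\<close> onto the
    intervals.\<close>
  have "(\<lambda>n. max (x n) (min (y n) z)) \<longlonglongrightarrow> max l (min r z)"
    by (intro tendsto_intros lim)
  then show "\<exists>p. (\<forall>n. p n \<in> {x n..y n}) \<and> p \<longlonglongrightarrow> z"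
    using z le by (intro exI[of _ "\<lambda>n. max (x n) (min (y n) z)"]) (auto simp: min_absorb2 max_absorb2)
next
  fix z assume "z \<notin> {l..r}"
  then consider "z < l" | "r < z" by fastforce
  then show "\<exists>U. open U \<and> z \<in> U \<and> (\<forall>\<^sub>F n in sequentially. U \<inter> {x n..y n} = {})"
  proof cases
    case 1
    then obtain m where m: "z < m" "m < l" using dense by blast
    show ?thesis
      using m order_tendstoD(1)[OF lim(1) m(2)]
      by (intro exI[of _ "{..<m}"]) (auto elim!: eventually_mono)
  next
    case 2
    then obtain m where m: "r < m" "m < z" using dense by blast
    show ?thesis
      using m order_tendstoD(2)[OF lim(2) m(1)]
      by (intro exI[of _ "{m<..}"]) (auto elim!: eventually_mono)
  qed
qed

section \<open>Best responses to threshold strategies\<close>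

context brownian_family
begin

text \<open>The line of slope \<open>\<beta>\<close> from the opponent's payment
  \<open>(c, g c)\<close> is tangent to \<open>f\<close> at \<open>r\<close>. It is a majorant,
  strictly above \<open>f\<close> on \<open>(c,r)\<close> and attained there by waiting for
  \<open>c\<close> or \<open>r\<close>, so such points continue. Beyond \<open>r\<close> concavity
  supplies at each point a support line that majorises all rewards, so such points stop.\<close>

lemma response_region_above:
  assumes f: "continuous_on {0..1} f" "f 1 = 0" and g: "continuous_on {0..1} g" "g 0 = 0" "g 1 = 0"
    and order: "0 \<le> c" "c < b" "b \<le> r" "r < 1"
    and convex: "strictly_convex_on {0..b} f" and concave: "strictly_concave_on {b..1} f"
    and fg: "f c \<le> g c"
    and touch: "f r = g c + \<beta> * (r - c)"
    and below: "\<And>y. y \<in> {b..1} \<Longrightarrow> y \<noteq> r \<Longrightarrow> f y < g c + \<beta> * (y - c)"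
  shows "response_region P W completed_filtration f g {0..c} = {r..1}"
proof -
  have A: "{c<..<1} \<subseteq> {0<..<1}" "{0..c} \<inter> {0<..<1} = {0<..<1} - {c<..<1}"
    using order by auto
  note upper = response_value_le_affine[OF A order(1) order_refl _ g(2,3) f(1) g(1)]
  note lower = response_value_ge_affine[OF A order(1) order_refl g(2,3) f(1) g(1)]
  define \<alpha> where "\<alpha> = g c - \<beta> * c"
  have line: "\<alpha> + \<beta> * y = g c + \<beta> * (y - c)" for y by (simp add: \<alpha>_def algebra_simps)
  have below': "f y \<le> \<alpha> + \<beta> * y" if "y \<in> {b..1}" for y
    using below[OF that] touch by (cases "y = r") (auto simp: line)
  have strict: "f y < \<alpha> + \<beta> * y" if "c < y" "y < r" for y
  proof (cases "b \<le> y")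
    case True
    then show ?thesis using below[of y] that order by (simp add: line)
  next
    case False
    \<comment> \<open>On the convex part up to \<open>b\<close> the line is above \<open>f\<close>
      at both ends: at \<open>c\<close> because \<open>f c \<le> g c\<close>, at \<open>b\<close> by
      the comparison on \<open>[b,1]\<close>.\<close>
    show ?thesis
      by (rule strictly_convex_on_less_chord[OF convex, of c b])
        (use that False order fg below'[of b] in \<open>auto simp: line[of c]\<close>)
  qed
  have maj: "f y \<le> \<alpha> + \<beta> * y" if "y \<in> {c..1}" for y
    using strict[of y] below'[of y] that order fg by (cases "y = c"; cases "y < r") (auto simp: line[of c])
  have stop: "response_value P W completed_filtration f g {0..c} x = f x" if x: "r \<le> x" "x \<le> 1" for x
  proof (cases "x = 1")
    case True
    then show ?thesis using f(2) by (simp add: response_value_outside)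
  next
    case False
    have "response_value P W completed_filtration f g {0..c} x \<le> f x"
    \<comment> \<open>At \<open>r\<close> the line itself is the majorant; a support line could be
      missing there, since \<open>r\<close> may equal \<open>b\<close>.\<close>
    proof (cases "x = r")
      case True
      show ?thesis
        using upper[of x \<alpha> \<beta>] maj maj[of 1] f(2) g(3) touch True order by (simp add: line[of c] line[of r])
    next
      case xr: False
      have "b < x" "x < 1" using x False xr order by auto
      then obtain \<gamma> where \<gamma>: "\<And>y. y \<in> {b..1} \<Longrightarrow> f y \<le> f x + \<gamma> * (y - x)"
        using strictly_concave_on_support_line[OF concave] by blast
      have "f r \<le> f x + \<gamma> * (r - x)" using order by (intro \<gamma>) auto
      moreover have "f x \<le> f r + \<beta> * (x - r)"
        using below'[of x] x order touch line[of x] by (simp add: algebra_simps)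
      ultimately have "(\<gamma> - \<beta>) * (x - r) \<le> 0" by (simp add: algebra_simps)
      \<comment> \<open>The support line at \<open>x\<close> rises no faster than the tangent and is
        not below it at \<open>r\<close>, so it stays above it everywhere to the left of
        \<open>r\<close>, in particular above \<open>g c\<close> at \<open>c\<close>.\<close>
      then have "\<gamma> \<le> \<beta>" using x xr by (simp add: mult_le_0_iff)
      have left: "\<alpha> + \<beta> * y \<le> f x + \<gamma> * (y - x)" if "y \<le> r" for y
      proof -
        have "\<gamma> * (r - y) \<le> \<beta> * (r - y)" using \<open>\<gamma> \<le> \<beta>\<close> that by (intro mult_right_mono) auto
        then show ?thesis
          using \<open>f r \<le> f x + \<gamma> * (r - x)\<close> touch by (simp add: line algebra_simps)
      qed
      have maj': "f y \<le> (f x - \<gamma> * x) + \<gamma> * y" if "y \<in> {c..1}" for y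
      proof (cases "y \<le> r")
        case True
        then show ?thesis using left[of y] maj[OF that] by (simp add: algebra_simps)
      next
        case False
        then show ?thesis using \<gamma>[of y] that order by (simp add: algebra_simps)
      qed
      show ?thesis
        using upper[of x "f x - \<gamma> * x" \<gamma>] maj' maj'[of 1] left[of c] f(2) g(3) x order
        by (simp add: line[of c] algebra_simps)
    qed
    moreover have "f x \<le> response_value P W completed_filtration f g {0..c} x"
      using lower[of x x x "f x" 0] x False order by simp
    ultimately show ?thesis by (rule antisym)
  qed
  have continue: "response_value P W completed_filtration f g {0..c} x > f x" if x: "c < x" "x < r" for x
    using lower[of c x r \<alpha> \<beta>] strict[OF x] x order touch by (simp add: line[of c] line[of r])
  show ?thesis
  proof (rule set_eqI)
    fix x
    show "x \<in> response_region P W completed_filtration f g {0..c} \<longleftrightarrow> x \<in> {r..1}"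
      using stop[of x] continue[of x] order by (fastforce simp: response_region_def)
  qed
qed

text \<open>The mirror image: the tangent to \<open>f\<close> now starts from
  \<open>(d, g d)\<close> and runs to the left, and support lines at points left of \<open>l\<close>
  are at least as steep as it.\<close>

lemma response_region_below:
  assumes f: "continuous_on {0..1} f" "f 0 = 0" and g: "continuous_on {0..1} g" "g 0 = 0" "g 1 = 0"
    and order: "0 < l" "l \<le> a" "a < d" "d \<le> 1"
    and concave: "strictly_concave_on {0..a} f" and convex: "strictly_convex_on {a..1} f"
    and fg: "f d \<le> g d"
    and touch: "f l = g d + \<beta> * (l - d)"
    and below: "\<And>y. y \<in> {0..a} \<Longrightarrow> y \<noteq> l \<Longrightarrow> f y < g d + \<beta> * (y - d)"
  shows "response_region P W completed_filtration f g {d..1} = {0..l}"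
proof -
  have A: "{0<..<d} \<subseteq> {0<..<1}" "{d..1} \<inter> {0<..<1} = {0<..<1} - {0<..<d}"
    using order by auto
  note upper = response_value_le_affine[OF A order_refl order(4) _ g(2,3) f(1) g(1)]
  note lower = response_value_ge_affine[OF A order_refl order(4) g(2,3) f(1) g(1)]
  define \<alpha> where "\<alpha> = g d - \<beta> * d"
  have line: "\<alpha> + \<beta> * y = g d + \<beta> * (y - d)" for y by (simp add: \<alpha>_def algebra_simps)
  have below': "f y \<le> \<alpha> + \<beta> * y" if "y \<in> {0..a}" for y
    using below[OF that] touch by (cases "y = l") (auto simp: line)
  have strict: "f y < \<alpha> + \<beta> * y" if "l < y" "y < d" for y
  proof (cases "y \<le> a")
    case True
    then show ?thesis using below[of y] that order by (simp add: line)
  next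
    case False
    show ?thesis
      by (rule strictly_convex_on_less_chord[OF convex, of a d])
        (use that False order fg below'[of a] in \<open>auto simp: line[of d]\<close>)
  qed
  have maj: "f y \<le> \<alpha> + \<beta> * y" if "y \<in> {0..d}" for y
    using strict[of y] below'[of y] that order fg by (cases "y = d"; cases "l < y") (auto simp: line[of d])
  have stop: "response_value P W completed_filtration f g {d..1} x = f x" if x: "0 \<le> x" "x \<le> l" for x
  proof (cases "x = 0")
    case True
    then show ?thesis using f(2) by (simp add: response_value_outside)
  next
    case False
    have "response_value P W completed_filtration f g {d..1} x \<le> f x"
    proof (cases "x = l")
      case True
      show ?thesis
        using upper[of x \<alpha> \<beta>] maj maj[of 0] f(2) g(2) touch True order by (simp add: line[of d] line[of l])
    next
      case xl: False
      have "0 < x" "x < a" using x False xl order by auto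
      then obtain \<gamma> where \<gamma>: "\<And>y. y \<in> {0..a} \<Longrightarrow> f y \<le> f x + \<gamma> * (y - x)"
        using strictly_concave_on_support_line[OF concave] by blast
      have "f l \<le> f x + \<gamma> * (l - x)" using order by (intro \<gamma>) auto
      moreover have "f x \<le> f l + \<beta> * (x - l)"
        using below'[of x] x order touch line[of x] by (simp add: algebra_simps)
      ultimately have "(\<beta> - \<gamma>) * (l - x) \<le> 0" by (simp add: algebra_simps)
      then have "\<beta> \<le> \<gamma>" using x xl by (simp add: mult_le_0_iff)
      have right: "\<alpha> + \<beta> * y \<le> f x + \<gamma> * (y - x)" if "l \<le> y" for y
      proof -
        have "\<beta> * (y - l) \<le> \<gamma> * (y - l)" using \<open>\<beta> \<le> \<gamma>\<close> that by (intro mult_right_mono) auto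
        then show ?thesis
          using \<open>f l \<le> f x + \<gamma> * (l - x)\<close> touch by (simp add: line algebra_simps)
      qed
      have maj': "f y \<le> (f x - \<gamma> * x) + \<gamma> * y" if "y \<in> {0..d}" for y
      proof (cases "l \<le> y")
        case True
        then show ?thesis using right[of y] maj[OF that] by (simp add: algebra_simps)
      next
        case False
        then show ?thesis using \<gamma>[of y] that order by (simp add: algebra_simps)
      qed
      show ?thesis
        using upper[of x "f x - \<gamma> * x" \<gamma>] maj' maj'[of 0] right[of d] f(2) g(2) x order
        by (simp add: line[of d] algebra_simps)
    qed
    moreover have "f x \<le> response_value P W completed_filtration f g {d..1} x"
      using lower[of x x x "f x" 0] x False order by simp
    ultimately show ?thesis by (rule antisym)
  qed
  have continue: "response_value P W completed_filtration f g {d..1} x > f x" if x: "l < x" "x < d" for x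
    using lower[of l x d \<alpha> \<beta>] strict[OF x] x order touch by (simp add: line[of d] line[of l])
  show ?thesis
  proof (rule set_eqI)
    fix x
    show "x \<in> response_region P W completed_filtration f g {d..1} \<longleftrightarrow> x \<in> {0..l}"
      using stop[of x] continue[of x] order by (fastforce simp: response_region_def)
  qed
qed

section \<open>Threshold solutions as coordinatewise minima of the slope\<close>

lemma hitting_time_lower: "\<omega> \<in> space M \<Longrightarrow> 0 \<le> l \<Longrightarrow> l < 1 \<Longrightarrow> hitting_time W {0..l} \<omega> = exit_from W l 1 \<omega>"
  by (rule hitting_time_eq_exit_from[OF continuous_paths]) auto

lemma hitting_time_upper: "\<omega> \<in> space M \<Longrightarrow> 0 < r \<Longrightarrow> r \<le> 1 \<Longrightarrow> hitting_time W {r..1} \<omega> = exit_from W 0 r \<omega>"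
  by (rule hitting_time_eq_exit_from[OF continuous_paths]) auto

lemma payoff_cong:
  assumes "\<And>\<omega>. \<omega> \<in> space M \<Longrightarrow> \<sigma> \<omega> = \<sigma>' \<omega>" "\<And>\<omega>. \<omega> \<in> space M \<Longrightarrow> \<tau> \<omega> = \<tau>' \<omega>"
  shows "payoff P W f g h x \<sigma> \<tau> = payoff P W f g h x \<sigma>' \<tau>'"
  unfolding payoff_def using assms by (intro Bochner_Integration.integral_cong) (simp_all add: space_P)

text \<open>At the midpoint of \<open>(p,q)\<close> the best response stops at once and earns
  \<open>f\<close> there, while waiting to leave \<open>(p,q)\<close> earns the average of
  \<open>f\<close> over the two ends. So a best response cannot stop on an interval of strict
  convexity.\<close>

lemma best_response_midpoint:
  assumes fgh: "continuous_on {0..1} f" "continuous_on {0..1} g" "continuous_on {0..1} h" "f 0 = 0" "f 1 = 0"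
    and best: "\<And>x \<sigma>. x \<in> {0<..<1} \<Longrightarrow> \<sigma> \<in> stopping_times completed_filtration \<Longrightarrow>
      payoff P W f g h x \<sigma> (exit_from W c d) \<le> payoff P W f g h x (exit_from W p0 q0) (exit_from W c d)"
    and cd: "0 \<le> c" "d \<le> 1" and pq: "c < p" "p < q" "q < d" and out: "(p + q) / 2 \<notin> {p0<..<q0}"
  shows "(f p + f q) / 2 \<le> f ((p + q) / 2)"
proof -
  let ?x = "(p + q) / 2"
  define \<beta> where "\<beta> = (f q - f p) / (q - p)"
  define \<alpha> where "\<alpha> = f p - \<beta> * p"
  have ends: "\<alpha> + \<beta> * p = f p" "\<alpha> + \<beta> * q = f q"
  proof -
    show "\<alpha> + \<beta> * p = f p" by (simp add: \<alpha>_def)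
    have "\<beta> * (q - p) = f q - f p" using pq by (simp add: \<beta>_def)
    then show "\<alpha> + \<beta> * q = f q" by (simp add: \<alpha>_def algebra_simps)
  qed
  have "\<alpha> + \<beta> * ?x = (f p + f q) / 2"
    unfolding ends[symmetric] by (simp add: field_simps)
  moreover have "payoff P W f g h ?x (exit_from W p q) (exit_from W c d) = \<alpha> + \<beta> * ?x"
    by (rule payoff_exit_from_affine) (use fgh cd pq ends in auto)
  moreover have "payoff P W f g h ?x (exit_from W p0 q0) (exit_from W c d) = f ?x"
    by (rule payoff_stop_at_once) (use fgh cd pq out in auto)
  moreover have "payoff P W f g h ?x (exit_from W p q) (exit_from W c d)
      \<le> payoff P W f g h ?x (exit_from W p0 q0) (exit_from W c d)"
    by (rule best[OF _ exit_from_stopping_times]) (use cd pq in auto)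
  ultimately show ?thesis by simp
qed

text \<open>Written with anchor \<open>(r, g r)\<close>, so that the player's own threshold
  \<open>l\<close> enters through the slope alone.\<close>

lemma payoff_lower_threshold:
  assumes fgh: "continuous_on {0..1} f" "continuous_on {0..1} g" "continuous_on {0..1} h" "f 0 = 0" "f 1 = 0"
    and "0 \<le> l" "l < x" "x < r" "r < 1"
  shows "payoff P W f g h x (exit_from W l 1) (exit_from W 0 r) = g r - (g r - f l) / (r - l) * (r - x)"
proof -
  define s where "s = (g r - f l) / (r - l)"
  have s: "g r - s * (r - l) = f l" using assms by (simp add: s_def)
  have "payoff P W f g h x (exit_from W l 1) (exit_from W 0 r) = (g r - s * r) + s * x"
    by (rule payoff_exit_from_affine) (use assms s in \<open>auto simp: algebra_simps\<close>)
  then show ?thesis by (simp add: s_def[symmetric] algebra_simps)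
qed

lemma payoff_upper_threshold:
  assumes fgh: "continuous_on {0..1} f" "continuous_on {0..1} g" "continuous_on {0..1} h" "f 0 = 0" "f 1 = 0"
    and "0 < l" "l < x" "x < r" "r \<le> 1"
  shows "payoff P W f g h x (exit_from W 0 r) (exit_from W l 1) = g l + (f r - g l) / (r - l) * (x - l)"
proof -
  define s where "s = (f r - g l) / (r - l)"
  have s: "g l + s * (r - l) = f r" using assms by (simp add: s_def)
  have "payoff P W f g h x (exit_from W 0 r) (exit_from W l 1) = (g l - s * l) + s * x"
    by (rule payoff_exit_from_affine) (use assms s in \<open>auto simp: algebra_simps\<close>)
  then show ?thesis by (simp add: s_def[symmetric] algebra_simps)
qed

lemma threshold_solution_best_responses:
  assumes rewards: "reward_functions f1 g1 h1" "reward_functions f2 g2 h2"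
    and sol: "threshold_solution P W completed_filtration f1 g1 h1 f2 g2 h2 l r"
    and x: "x \<in> {0<..<1}" and \<sigma>: "\<sigma> \<in> stopping_times completed_filtration"
  shows "payoff P W f1 g1 h1 x \<sigma> (exit_from W 0 r) \<le> payoff P W f1 g1 h1 x (exit_from W l 1) (exit_from W 0 r)"
    and "payoff P W f2 g2 h2 x \<sigma> (exit_from W l 1) \<le> payoff P W f2 g2 h2 x (exit_from W 0 r) (exit_from W l 1)"
proof -
  have lr: "0 < l" "l < 1" "0 < r" "r < 1"
    and dp: "dp_solution P W completed_filtration f1 g1 h1 f2 g2 h2 (hitting_time W {0..l}) (hitting_time W {r..1})"
    using sol by (auto simp: threshold_solution_def)
  note cong = payoff_cong[OF hitting_time_lower hitting_time_upper]
    payoff_cong[OF hitting_time_upper hitting_time_lower] payoff_cong[OF refl hitting_time_lower]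
    payoff_cong[OF refl hitting_time_upper]
  have c: "continuous_on {0..1} f1" "continuous_on {0..1} g1" "continuous_on {0..1} h1"
    "continuous_on {0..1} f2" "continuous_on {0..1} g2" "continuous_on {0..1} h2"
    using rewards by (auto simp: reward_functions_def)
  show "payoff P W f1 g1 h1 x \<sigma> (exit_from W 0 r) \<le> payoff P W f1 g1 h1 x (exit_from W l 1) (exit_from W 0 r)"
    using dp x cSUP_upper[OF \<sigma> payoff_bdd_above[OF c(1-3), where \<tau>="exit_from W 0 r"]] lr
    by (simp add: dp_solution_def cong)
  show "payoff P W f2 g2 h2 x \<sigma> (exit_from W l 1) \<le> payoff P W f2 g2 h2 x (exit_from W 0 r) (exit_from W l 1)"
    using dp x cSUP_upper[OF \<sigma> payoff_bdd_above[OF c(4-6), where \<tau>="exit_from W l 1"]] lr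
    by (simp add: dp_solution_def cong)
qed

end

lemma strictly_convex_on_cong:
  assumes f: "strictly_convex_on S f" and eq: "\<And>x. x \<in> S \<Longrightarrow> f x = g x"
  shows "strictly_convex_on S g"
  unfolding strictly_convex_on_def
proof (intro conjI ballI allI impI)
  show S: "convex S" using f by (simp add: strictly_convex_on_def)
  fix x y u v :: real
  assume xy: "x \<in> S" "y \<in> S" and uv: "0 < u" "0 < v" "x \<noteq> y \<and> u + v = 1"
  have "u * x + v * y \<in> S" using convexD[OF S xy, of u v] uv by simp
  moreover have "f (u * x + v * y) < u * f x + v * f y"
    using f xy uv unfolding strictly_convex_on_def by blast
  ultimately show "g (u * x + v * y) < u * g x + v * g y" using eq xy by simp
qed

text \<open>Only deviations to other exit times are needed. Short intervals inside the stopping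
  region place the thresholds in \<open>[0,a]\<close> and \<open>[b,1]\<close>; other thresholds
  then change the payoff only through the slope, so being a best response means minimising
  it.\<close>

lemma (in brownian_family) threshold_solution_minimises_slope:
  fixes f1 g1 h1 f2 g2 h2 :: "real \<Rightarrow> real"
  defines "S \<equiv> \<lambda>x y. (g1 y - f1 x) / (y - x)"
  assumes rewards: "reward_functions f1 g1 h1" "reward_functions f2 g2 h2"
    and ab: "0 < a" "a < b" "b < 1"
    and f1_convex: "strictly_convex_on {a..1} f1" and f2_convex: "strictly_convex_on {0..b} f2"
    and zero_sum: "\<And>x. x \<in> {0..1} \<Longrightarrow> f1 x = - g2 x" "\<And>x. x \<in> {0..1} \<Longrightarrow> f2 x = - g1 x"
    and sol: "threshold_solution P W completed_filtration f1 g1 h1 f2 g2 h2 l r"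
  shows "0 < l" "l \<le> a" "b \<le> r" "r < 1"
    and "\<And>l'. l' \<in> {0..a} \<Longrightarrow> S l r \<le> S l' r"
    and "\<And>r'. r' \<in> {b..1} \<Longrightarrow> S l r \<le> S l r'"
proof -
  show l: "0 < l" and r: "r < 1" using sol by (auto simp: threshold_solution_def)
  have lr: "l < r" "l < 1" "0 < r" using sol by (auto simp: threshold_solution_def)
  note best = threshold_solution_best_responses[OF rewards sol]
  have c: "continuous_on {0..1} f1" "continuous_on {0..1} g1" "continuous_on {0..1} h1"
    "continuous_on {0..1} f2" "continuous_on {0..1} g2" "continuous_on {0..1} h2"
    and z: "f1 0 = 0" "f1 1 = 0" "f2 0 = 0" "f2 1 = 0"
    using rewards by (auto simp: reward_functions_def)
  have midpoint: "f ((p + q) / 2) < (f p + f q) / 2"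
    if "strictly_convex_on S f" "p \<in> S" "q \<in> S" "p < q" for f :: "real \<Rightarrow> real" and S p q
  proof -
    have "\<forall>u>0. \<forall>v>0. p \<noteq> q \<and> u + v = 1 \<longrightarrow> f (u * p + v * q) < u * f p + v * f q"
      using that(1-3) unfolding strictly_convex_on_def by blast
    from this[rule_format, of "1 / 2" "1 / 2"] show ?thesis
      using that(4) by (simp add: add_divide_distrib)
  qed
  show la: "l \<le> a"
  proof (rule ccontr)
    assume "\<not> l \<le> a"
    then obtain m where m: "a < m" "m < l" using dense[of a l] by auto
    then have "(f1 a + f1 m) / 2 \<le> f1 ((a + m) / 2)"
      using ab lr r by (intro best_response_midpoint[OF c(1-3) z(1,2) best(1)]) auto
    then show False
      using midpoint[OF f1_convex, of a m] m ab lr by simp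
  qed
  show br: "b \<le> r"
  proof (rule ccontr)
    assume "\<not> b \<le> r"
    then obtain m where m: "r < m" "m < b" using dense[of r b] by auto
    then have "(f2 m + f2 b) / 2 \<le> f2 ((m + b) / 2)"
      using ab lr l by (intro best_response_midpoint[OF c(4-6) z(3,4) best(2)]) auto
    then show False
      using midpoint[OF f2_convex, of m b] m ab lr by simp
  qed
  show "S l r \<le> S l' r" if l': "l' \<in> {0..a}" for l'
  proof -
    \<comment> \<open>A starting point between both candidate thresholds and \<open>r\<close>, where
      both strategies still continue and both payoff formulas apply.\<close>
    define x where "x = (max l l' + r) / 2"
    have x: "l < x" "l' < x" "x < r" "x \<in> {0<..<1}"
      using l' la br ab l r lr by (auto simp: x_def max_def)
    have "payoff P W f1 g1 h1 x (exit_from W l' 1) (exit_from W 0 r) = g1 r - S l' r * (r - x)"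
      "payoff P W f1 g1 h1 x (exit_from W l 1) (exit_from W 0 r) = g1 r - S l r * (r - x)"
      unfolding S_def using payoff_lower_threshold[OF c(1-3) z(1,2)] l' l r x by auto
    then have "S l r * (r - x) \<le> S l' r * (r - x)"
      using best(1)[OF x(4) exit_from_stopping_times[of l' 1]] by simp
    then show ?thesis using x by simp
  qed
  show "S l r \<le> S l r'" if r': "r' \<in> {b..1}" for r'
  proof -
    define x where "x = (l + min r r') / 2"
    have x: "l < x" "x < r" "x < r'" "x \<in> {0<..<1}"
      using r' la br ab l r lr by (auto simp: x_def min_def)
    \<comment> \<open>Here the zero-sum relation enters: player 2 maximises the negative of the
      slope that player 1 minimises.\<close>
    have slope: "(f2 y - g2 l) / (y - l) = - S l y" if "y \<in> {0..1}" for y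
      using zero_sum that l lr by (simp add: S_def minus_divide_left)
    have "r' \<in> {0..1}" "r \<in> {0..1}" using r' r ab lr by auto
    note slopes = this[THEN slope, symmetric]
    have "payoff P W f2 g2 h2 x (exit_from W 0 r') (exit_from W l 1) = g2 l + (- S l r') * (x - l)"
      "payoff P W f2 g2 h2 x (exit_from W 0 r) (exit_from W l 1) = g2 l + (- S l r) * (x - l)"
      unfolding slopes by (rule payoff_upper_threshold[OF c(4-6) z(3,4)]; use r' l r x in simp)+
    then have "S l r * (x - l) \<le> S l r' * (x - l)"
      using best(2)[OF x(4) exit_from_stopping_times[of 0 r']] by simp
    then show ?thesis using x by simp
  qed
qed

section \<open>Convergence of the iterated best responses in the zero-sum game\<close>

theorem theorem5p4:
  fixes M :: "'w measure" and G :: "ennreal \<Rightarrow> 'w measure"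
    and P :: "real \<Rightarrow> 'w measure" and W :: "real \<Rightarrow> 'w \<Rightarrow> real"
    and F :: "ennreal \<Rightarrow> 'w measure"
    and f1 g1 h1 f2 g2 h2 :: "real \<Rightarrow> real"
    and a b :: real
  assumes brownian: "brownian_family M G P W"
    and filtration: "F = universal_completion M P G"
    and rewards: "reward_functions f1 g1 h1" "reward_functions f2 g2 h2"
    and ab: "a \<in> {0<..<1}" "b \<in> {0<..<1}" "a < b"
    and f1_shape: "strictly_concave_on {0..a} f1" "strictly_convex_on {a..1} f1"
    and f2_shape: "strictly_convex_on {0..b} f2" "strictly_concave_on {b..1} f2"
    and smooth: "C2_on {0..1} f1" "C2_on {0..1} g1" "C2_on {0..1} f2" "C2_on {0..1} g2"
    and improvement: "\<forall>x\<in>{0..a}. \<forall>y\<in>{b..1}. \<exists>x'\<in>{0<..a}. \<exists>y'\<in>{b..<1}.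
          f1 x' > g1 y * (x' / y) \<and> f2 y' > g2 x * ((1 - y') / (1 - x))"
    and zero_sum: "\<forall>x\<in>{0..1}. f1 x = - g2 x" "\<forall>x\<in>{0..1}. f2 x = - g1 x"
  shows "\<forall>l r. threshold_solution P W F f1 g1 h1 f2 g2 h2 l r \<longrightarrow>
           locally_stable P W F f1 g1 f2 g2 a l r"
proof (intro allI impI)
  fix l r assume sol: "threshold_solution P W F f1 g1 h1 f2 g2 h2 l r"
  interpret brownian_family M G P W by (rule brownian)
  have F: "F = completed_filtration" by (rule filtration)
  have c: "continuous_on {0..1} f1" "continuous_on {0..1} g1" "continuous_on {0..1} f2" "continuous_on {0..1} g2"
    and z: "f1 0 = 0" "f1 1 = 0" "g1 0 = 0" "g1 1 = 0" "f2 0 = 0" "f2 1 = 0" "g2 0 = 0" "g2 1 = 0"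
    and fg: "\<And>x. x \<in> {0..1} \<Longrightarrow> f1 x \<le> g1 x" "\<And>x. x \<in> {0..1} \<Longrightarrow> f2 x \<le> g2 x"
    using rewards by (auto simp: reward_functions_def intro: order_trans)
  have zs: "g2 x = - f1 x" "f2 x = - g1 x" if "x \<in> {0..1}" for x using zero_sum that by auto
  define S where "S x y = (g1 y - f1 x) / (y - x)" for x y
  note min_lr = threshold_solution_minimises_slope[OF rewards, of a b l r, folded S_def]
  have lr: "l \<in> {0..a}" "r \<in> {b..1}" "\<And>l'. l' \<in> {0..a} \<Longrightarrow> S l r \<le> S l' r"
    "\<And>r'. r' \<in> {b..1} \<Longrightarrow> S l r \<le> S l r'"
    using min_lr[OF _ _ _ f1_shape(2) f2_shape(1)] ab zero_sum sol by (auto simp: F)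
  have g1_convex: "strictly_convex_on {b..1} g1"
    by (rule strictly_convex_on_cong[OF f2_shape(2)[unfolded strictly_concave_on_def]])
      (use zs(2) ab in auto)
  have "\<forall>x\<in>{0..a}. \<exists>y\<in>{b..1}. \<forall>y'\<in>{b..1}. y' \<noteq> y \<longrightarrow> S x y < S x y'"
  proof
    fix x assume x: "x \<in> {0..a}"
    show "\<exists>y\<in>{b..1}. \<forall>y'\<in>{b..1}. y' \<noteq> y \<longrightarrow> S x y < S x y'"
      using convex_ratio_unique_minimiser[OF g1_convex continuous_on_subset[OF c(2)], of "- x" 1 "- f1 x"] x ab
      by (auto simp: S_def)
  qed
  \<comment> \<open>\<open>up\<close> and its counterpart \<open>lo\<close> are the threshold best
    responses; at this stage they are only the unique minimisers of the slope in one
    variable.\<close>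
  then obtain up where up: "\<And>x. x \<in> {0..a} \<Longrightarrow> up x \<in> {b..1}"
    "\<And>x y. x \<in> {0..a} \<Longrightarrow> y \<in> {b..1} \<Longrightarrow> y \<noteq> up x \<Longrightarrow> S x (up x) < S x y" by metis
  have "\<forall>y\<in>{b..1}. \<exists>x\<in>{0..a}. \<forall>x'\<in>{0..a}. x' \<noteq> x \<longrightarrow> S x y < S x' y"
  proof
    fix y assume y: "y \<in> {b..1}"
    have "strictly_convex_on {0..a} (\<lambda>x. - f1 x)" using f1_shape(1) by (simp add: strictly_concave_on_def)
    moreover have "continuous_on {0..a} (\<lambda>x. - f1 x)"
      using ab by (intro continuous_intros continuous_on_subset[OF c(1)]) auto
    ultimately show "\<exists>x\<in>{0..a}. \<forall>x'\<in>{0..a}. x' \<noteq> x \<longrightarrow> S x y < S x' y"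
      using convex_ratio_unique_minimiser[of 0 a "\<lambda>x. - f1 x" y "- 1" "g1 y"] y ab
      by (auto simp: S_def)
  qed
  then obtain lo where lo: "\<And>y. y \<in> {b..1} \<Longrightarrow> lo y \<in> {0..a}"
    "\<And>x y. y \<in> {b..1} \<Longrightarrow> x \<in> {0..a} \<Longrightarrow> x \<noteq> lo y \<Longrightarrow> S (lo y) y < S x y" by metis
  have S_eq: "S x y * (y - x) = g1 y - f1 x" if "x \<in> {0..a}" "y \<in> {b..1}" for x y
    using that ab by (simp add: S_def)
  have S_less: "S x y < s \<longleftrightarrow> g1 y - f1 x < s * (y - x)" "s < S x y \<longleftrightarrow> s * (y - x) < g1 y - f1 x"
    if "x \<in> {0..a}" "y \<in> {b..1}" for x y s
    using that ab by (auto simp: S_def pos_divide_less_eq pos_less_divide_eq)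
  \<comment> \<open>The second inequality of condition (4) puts a point of the graph of
    \<open>f2\<close> strictly above the chord from \<open>(x, g2 x)\<close> to
    \<open>(1, 0)\<close>. In terms of slopes this is \<open>S x y < S x 1\<close>, so 1 is not the
    minimiser.\<close>
  have up_less: "up x < 1" if x: "x \<in> {0..a}" for x
  proof (rule ccontr)
    assume "\<not> up x < 1"
    then have up1: "up x = 1" using up(1)[OF x] by simp
    obtain y where y: "y \<in> {b..<1}" "f2 y > g2 x * ((1 - y) / (1 - x))"
      using improvement x ab by fastforce
    have "S x 1 < S x y" using up(2)[OF x, of y] y up1 ab by simp
    then have "S x 1 * (y - x) < g1 y - f1 x" using x y ab by (simp add: S_less)
    moreover have "S x 1 = g2 x / (1 - x)" using z zs x ab by (simp add: S_def)
    ultimately have "g2 x / (1 - x) * (y - x) < g2 x - f2 y" using zs[of x] zs[of y] x y ab by simp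
    moreover have "g2 x / (1 - x) * (y - x) = g2 x - g2 x * ((1 - y) / (1 - x))"
      using x ab by (simp add: field_simps)
    ultimately show False using y(2) by simp
  qed
  \<comment> \<open>Likewise the first inequality of (4) puts a point of the graph of
    \<open>f1\<close> above the chord from \<open>(0, 0)\<close> to
    \<open>(y, g1 y)\<close>.\<close>
  have lo_pos: "0 < lo y" if y: "y \<in> {b..1}" for y
  proof (rule ccontr)
    assume "\<not> 0 < lo y"
    then have lo0: "lo y = 0" using lo(1)[OF y] by simp
    obtain x where x: "x \<in> {0<..a}" "f1 x > g1 y * (x / y)"
      using improvement y ab by fastforce
    have "S 0 y < S x y" using lo(2)[OF y, of x] x lo0 by simp
    then have "S 0 y * (y - x) < g1 y - f1 x" using x y ab by (simp add: S_less)
    moreover have "S 0 y = g1 y / y" using z by (simp add: S_def)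
    moreover have "g1 y / y * (y - x) = g1 y - g1 y * (x / y)"
      using y ab by (simp add: field_simps)
    ultimately show False using x(2) by simp
  qed
  \<comment> \<open>Reflecting both graphs by \<open>f2 = - g1\<close> and \<open>g2 = - f1\<close>
    negates the slope: the least slope line from \<open>f1\<close> to \<open>g1\<close> becomes the
    tangent from \<open>(x, g2 x)\<close> to \<open>f2\<close>.\<close>
  have upper: "response_region P W F f2 g2 {0..x} = {up x..1}" if x: "x \<in> {0..a}" for x
    unfolding F
  proof (rule response_region_above[where b=b and \<beta>="- S x (up x)"])
    show "f2 (up x) = g2 x + - S x (up x) * (up x - x)"
      using S_eq[OF x up(1)[OF x]] zs[of "up x"] zs[of x] x up(1)[OF x] ab by simp
    fix y assume y: "y \<in> {b..1}" "y \<noteq> up x"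
    then show "f2 y < g2 x + - S x (up x) * (y - x)"
      using up(2)[OF x y] S_less(2)[OF x y(1)] zs[of y] zs[of x] x ab by simp
  qed (use c z x ab up(1)[OF x] up_less[OF x] f2_shape fg in auto)
  have lower: "response_region P W F f1 g1 {y..1} = {0..lo y}" if y: "y \<in> {b..1}" for y
    unfolding F
  proof (rule response_region_below[where a=a and \<beta>="S (lo y) y"])
    show "f1 (lo y) = g1 y + S (lo y) y * (lo y - y)"
      using S_eq[OF lo(1)[OF y] y] by (simp add: algebra_simps)
    fix x assume x: "x \<in> {0..a}" "x \<noteq> lo y"
    then show "f1 x < g1 y + S (lo y) y * (x - y)"
      using lo(2)[OF y x] S_less(2)[OF x(1) y] by (simp add: algebra_simps)
  qed (use c z y ab lo(1)[OF y] lo_pos[OF y] f1_shape fg in auto)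
  have up_le: "S x (up x) \<le> S x y" if "x \<in> {0..a}" "y \<in> {b..1}" for x y
    using up(2)[OF that] by (cases "y = up x") auto
  have lo_le: "S (lo y) y \<le> S x y" if "x \<in> {0..a}" "y \<in> {b..1}" for x y
    using lo(2)[OF that(2,1)] by (cases "x = lo y") auto
  \<comment> \<open>The equilibrium is a minimum in each variable and minimisers are unique, so it
    is a fixed point of the responses and both of its minima are strict.\<close>
  have "up l = r"
    using lr(4)[OF up(1)[OF lr(1)]] up(2)[OF lr(1,2)] by force
  then have strict_r: "S l r < S l y" if "y \<in> {b..1}" "y \<noteq> r" for y
    using up(2)[OF lr(1)] that by blast
  have "lo r = l"
    using lr(3)[OF lo(1)[OF lr(2)]] lo(2)[OF lr(2,1)] by force
  then have strict_l: "S l r < S x r" if "x \<in> {0..a}" "x \<noteq> l" for x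
    using lo(2)[OF lr(2)] that by blast
  have S_cont: "continuous_on ({0..a} \<times> {b..1}) (\<lambda>p. S (fst p) (snd p))"
    unfolding S_def using ab
    by (intro continuous_intros continuous_on_compose2[OF c(1)] continuous_on_compose2[OF c(2)]) auto
  have "pk_liminf (\<lambda>n. A (2 * n + 1)) = {0..l} \<and> pk_limsup (\<lambda>n. A (2 * n + 1)) = {0..l} \<and>
        pk_liminf (\<lambda>n. A (2 * n + 2)) = {r..1} \<and> pk_limsup (\<lambda>n. A (2 * n + 2)) = {r..1}"
    if l1: "l1 \<in> {0..a}" and A: "A = iterate P W F f1 g1 f2 g2 l1" for l1 A
  proof -
    \<comment> \<open>Indices start at 0: \<open>x n\<close> is the threshold of
      \<open>A (2 * n + 1)\<close> and \<open>y n\<close> that of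
      \<open>A (2 * n + 2)\<close>.\<close>
    define x where "x n = ((\<lambda>x. lo (up x)) ^^ n) l1" for n
    define y where "y n = up (x n)" for n
    have x_mem: "x n \<in> {0..a}" for n
      by (induction n) (use l1 up(1) lo(1) in \<open>auto simp: x_def\<close>)
    have y_mem: "y n \<in> {b..1}" for n unfolding y_def by (rule up(1)[OF x_mem])
    have x_Suc: "x (Suc n) = lo (y n)" for n by (simp add: x_def y_def)
    have A_even: "A (2 * n + 2) = {y n..1}" if "A (2 * n + 1) = {0..x n}" for n
      using that upper[OF x_mem[of n]] by (simp add: A y_def)
    have A_odd: "A (2 * n + 1) = {0..x n}" for n
    proof (induction n)
      case 0
      then show ?case by (simp add: A x_def)
    next
      case (Suc n)
      then show ?case using A_even[of n] lower[OF y_mem[of n]] by (simp add: A x_Suc)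
    qed
    have min_y: "S (x n) (y n) \<le> S (x n) y'" if "y' \<in> {b..1}" for n y'
      unfolding y_def by (rule up_le[OF x_mem that])
    have min_x: "S (x (Suc n)) (y n) \<le> S x' (y n)" if "x' \<in> {0..a}" for n x'
      unfolding x_Suc by (rule lo_le[OF that y_mem])
    have unique: "x' = l \<and> y' = r"
      if "x' \<in> {0..a}" "y' \<in> {b..1}" "\<And>y''. y'' \<in> {b..1} \<Longrightarrow> S x' y' \<le> S x' y''"
        "\<And>x''. x'' \<in> {0..a} \<Longrightarrow> S x' y' \<le> S x'' y'" for x' y'
      by (rule coordinatewise_minimum_slope_unique[of "{0..a}" "{b..1}" x' y' l r g1 f1, folded S_def])
        (use that lr strict_r strict_l ab in auto)
    note lim = alternating_minimisation_tendsto[where S=S and x=x and y=y and l=l and r=r, OF compact_Icc compact_Icc S_cont x_mem y_mem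
        min_y min_x unique]
    have "pk_liminf (\<lambda>n. {0..x n}) = {0..l} \<and> pk_limsup (\<lambda>n. {0..x n}) = {0..l}"
      by (rule pk_lim_Icc[OF tendsto_const lim(1)]) (use x_mem in auto)
    moreover have "pk_liminf (\<lambda>n. {y n..1}) = {r..1} \<and> pk_limsup (\<lambda>n. {y n..1}) = {r..1}"
      by (rule pk_lim_Icc[OF lim(2) tendsto_const]) (use y_mem in auto)
    ultimately show ?thesis unfolding A_odd A_even[OF A_odd] by blast
  qed
  then show "locally_stable P W F f1 g1 f2 g2 a l r"
    \<comment> \<open>Convergence holds from all of \<open>[0,a]\<close>, so the whole line serves
      as the neighbourhood.\<close>
    unfolding locally_stable_def Let_def by (intro exI[of _ UNIV]) auto
qed

end
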